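(* For every dimension $d\ge 2$ there exist constants $a_d,A_d>0$ and an integer $T'_d$, depending only on $d$, such that for every $\delta>0$ and every integer $T> T'_d$, \[ \delta\cdot 2^{-2^{A_d T}}\;\le\;\mathsf{ExcessErr}_d(T,\delta)\;\le\;\delta\cdot 2^{-2^{a_d T}} . \]
   Context: Linear reconstruction game: fix $d\ge 1$, a number of rounds $T\ge 0$ and a noise level $\delta>0$. An adversary holds a secret point $x^*\in\mathbb{R}^d$. In each round $t=1,\dots,T$ the reconstructor chooses a unit vector $v_t\in S^{d-1}$ (possibly adaptively, as a function of previous answers) and the adversary returns a real number $r_t$ with $|r_t-\langle x^*,v_t\rangle|\le\delta$. After $T$ rounds the reconstructor outputs $\hat x_T\in\mathbb{R}^d$. All strategies are deterministic. The optimal reconstruction error is $\mathrm{OPT}_d(T,\delta)=\inf_{\mathcal R}\sup_{x^*\in\mathbb{R}^d}\sup_{\mathcal A}\|\hat x_T-x^*\|_2$, where $\mathcal R$ ranges over reconstructor strategies for $T$ rounds and $\mathcal A$ over adversary answer strategies satisfying the noise constraint for the secret $x^*$. This quantity is nonincreasing in $T$; set $\mathrm{OPT}_d(\infty,\delta):=\lim_{T\to\infty}\mathrm{OPT}_d(T,\delta)$ and $\mathsf{ExcessErr}_d(T,\delta):=\mathrm{OPT}_d(T,\delta)-\mathrm{OPT}_d(\infty,\delta)$. *)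

theory Defs
  imports "HOL-Analysis.Analysis"
begin

text \<open>Linear reconstruction game in dimension CARD('n).
  A deterministic (adaptive) reconstructor strategy for T rounds is a pair (Q, Out):
  Q h is the unit query vector chosen after having seen the answer history h
  (a list of the previous answers, so the query of round t+1 is Q (take t r)),
  and Out r is the output after the full answer list r of length T.
  Since the reconstructor is deterministic, the set of transcripts an adversary
  can produce for secret x is exactly the set of answer lists consistent with x.\<close>

definition consistent ::
  "(real list \<Rightarrow> real^'n) \<Rightarrow> nat \<Rightarrow> real \<Rightarrow> real^'n \<Rightarrow> real list \<Rightarrow> bool" where
  "consistent Q T \<delta> x r \<longleftrightarrow>
     length r = T \<and> (\<forall>t<T. \<bar>r ! t - inner x (Q (take t r))\<bar> \<le> \<delta>)"

definition unit_queries :: "(real list \<Rightarrow> real^'n) \<Rightarrow> bool" where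
  "unit_queries Q \<longleftrightarrow> (\<forall>h. norm (Q h) = 1)"

definition recon_err ::
  "nat \<Rightarrow> real \<Rightarrow> (real list \<Rightarrow> real^'n) \<Rightarrow> (real list \<Rightarrow> real^'n) \<Rightarrow> ereal" where
  "recon_err T \<delta> Q Out =
     (SUP p \<in> {(x, r). consistent Q T \<delta> x r}. ereal (norm (Out (snd p) - fst p)))"

definition OPT :: "'n::finite itself \<Rightarrow> nat \<Rightarrow> real \<Rightarrow> ereal" where
  "OPT _ T \<delta> =
     (INF s \<in> {(Q :: real list \<Rightarrow> real^'n, Out :: real list \<Rightarrow> real^'n). unit_queries Q}.
        recon_err T \<delta> (fst s) (snd s))"

text \<open>OPT_d(infinity, delta) as the limit of the nonincreasing sequence OPT_d(T, delta).\<close>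
definition OPT_inf :: "'n::finite itself \<Rightarrow> real \<Rightarrow> ereal" where
  "OPT_inf n \<delta> = lim (\<lambda>T. OPT n T \<delta>)"

definition ExcessErr :: "'n::finite itself \<Rightarrow> nat \<Rightarrow> real \<Rightarrow> ereal" where
  "ExcessErr n T \<delta> = OPT n T \<delta> - OPT_inf n \<delta>"

end

theory Submission
  imports Defs
begin

text \<open>After rescaling to \<open>\<delta> = 1\<close>, put \<open>J = sqrt (2 d / (d + 1))\<close>, the circumradius of the regular
  \<open>d\<close>-simplex \<open>\<Delta>\<close> of side 2. All answers are compatible with such a simplex, and by Jung's theorem a set
  of diameter 2 lies in a ball of radius \<open>J\<close>, so \<open>OPT\<close> tends to \<open>J\<close>.

  Lower bound: the adversary keeps \<open>\<eta>\<close>-balls around the vertices of a regular simplex feasible. A query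
  \<open>v\<close> is harmful only if it is almost parallel to an edge; rotating that edge away from \<open>v\<close> by an angle
  of order \<open>\<eta>\<close> shortens its projection by order \<open>\<eta>\<^sup>2\<close>, which leaves room for balls of radius of order
  \<open>\<eta>\<^sup>2\<close>. Hence the slack is squared in every round.

  Upper bound: finitely many queries bring the diameter close to 2. If the feasible set is still not
  contained in a ball of radius \<open>J\<close>, then by Helly's theorem it contains \<open>d + 1\<close> points witnessing this,
  which form an almost regular simplex, and a compactness argument shows that any two such witnesses
  are \<open>\<eta>\<close>-close up to relabelling. Querying the edge directions of one witness bounds the edges of every
  later witness by \<open>2 + O(\<eta>\<^sup>2)\<close>, because the components orthogonal to the query are of size \<open>O(\<eta>)\<close>.
  So one block of \<open>O(d\<^sup>2)\<close> queries replaces \<open>\<eta>\<close> by \<open>O(\<eta>\<^sup>2)\<close>.\<close>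

section \<open>Jung radius by duality\<close>

text \<open>For weights of sum 1 this is the variance of the weighted points. The pairwise form
  involves distances only, hence is translation invariant; the factor 1/2 compensates for ordered
  pairs.\<close>

definition gvar :: "('i::finite \<Rightarrow> real) \<Rightarrow> ('i \<Rightarrow> 'a::real_inner) \<Rightarrow> real" where
  "gvar l p = (\<Sum>i\<in>UNIV. \<Sum>j\<in>UNIV. l i * l j * (norm (p i - p j))\<^sup>2) / 2"

section \<open>Variance identities\<close>

lemma norm_diff_sq: "(norm (x - y :: 'a::real_inner))\<^sup>2 = (norm x)\<^sup>2 - 2 * (x \<bullet> y) + (norm y)\<^sup>2"
  by (simp add: power2_norm_eq_inner inner_diff inner_commute)

lemma norm_add_sq: "(norm (x + y :: 'a::real_inner))\<^sup>2 = (norm x)\<^sup>2 + 2 * (x \<bullet> y) + (norm y)\<^sup>2"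
  by (simp add: power2_norm_eq_inner inner_add inner_commute)

lemma norm_lincomb_sq:
  fixes p :: "'i::finite \<Rightarrow> 'a::real_inner"
  shows "(norm (\<Sum>i\<in>UNIV. l i *\<^sub>R p i))\<^sup>2 = (\<Sum>i\<in>UNIV. \<Sum>j\<in>UNIV. l i * l j * (p i \<bullet> p j))"
  by (simp add: power2_norm_eq_inner inner_sum_left inner_sum_right sum_distrib_left mult.assoc)
    (simp add: inner_commute)

lemma gvar_eq:
  fixes p :: "'i::finite \<Rightarrow> 'a::real_inner"
  shows "gvar l p = sum l UNIV * (\<Sum>i\<in>UNIV. l i * (norm (p i))\<^sup>2) - (norm (\<Sum>i\<in>UNIV. l i *\<^sub>R p i))\<^sup>2"
proof -
  have "2 * gvar l p = (\<Sum>i\<in>UNIV. \<Sum>j\<in>UNIV. l j * (l i * (norm (p i))\<^sup>2) + l i * (l j * (norm (p j))\<^sup>2)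
      - 2 * (l i * l j * (p i \<bullet> p j)))"
    unfolding gvar_def by (simp add: norm_diff_sq algebra_simps)
  also have "\<dots> = (\<Sum>i\<in>UNIV. \<Sum>j\<in>UNIV. l j * (l i * (norm (p i))\<^sup>2))
      + (\<Sum>i\<in>UNIV. \<Sum>j\<in>UNIV. l i * (l j * (norm (p j))\<^sup>2))
      - 2 * (\<Sum>i\<in>UNIV. \<Sum>j\<in>UNIV. l i * l j * (p i \<bullet> p j))"
    by (simp add: sum.distrib sum_subtractf sum_distrib_left)
  also have "(\<Sum>i\<in>UNIV. \<Sum>j\<in>UNIV. l j * (l i * (norm (p i))\<^sup>2)) = sum l UNIV * (\<Sum>i\<in>UNIV. l i * (norm (p i))\<^sup>2)"
    by (simp add: sum_product) (rule sum.swap)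
  also have "(\<Sum>i\<in>UNIV. \<Sum>j\<in>UNIV. l i * (l j * (norm (p j))\<^sup>2)) = sum l UNIV * (\<Sum>i\<in>UNIV. l i * (norm (p i))\<^sup>2)"
    by (simp add: sum_product)
  finally show ?thesis by (simp add: norm_lincomb_sq)
qed

text \<open>Parallel axis theorem: apply \<open>gvar_eq\<close> to the points shifted by
  \<open>z\<close>, which leaves \<open>gvar\<close> unchanged.\<close>

lemma sum_weighted_dist_sq:
  fixes p :: "'i::finite \<Rightarrow> 'a::real_inner"
  assumes "sum l UNIV = 1"
  shows "(\<Sum>i\<in>UNIV. l i * (norm (p i - z))\<^sup>2) = gvar l p + (norm ((\<Sum>i\<in>UNIV. l i *\<^sub>R p i) - z))\<^sup>2"
proof -
  have "gvar l p = gvar l (\<lambda>i. p i - z)" by (simp add: gvar_def)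
  moreover have "(\<Sum>i\<in>UNIV. l i *\<^sub>R (p i - z)) = (\<Sum>i\<in>UNIV. l i *\<^sub>R p i) - z"
    using assms by (simp add: scaleR_diff_right sum_subtractf flip: scaleR_left.sum)
  ultimately show ?thesis using gvar_eq[of l "\<lambda>i. p i - z"] assms by simp
qed

text \<open>The first term of \<open>gvar_eq\<close> vanishes, so the length of such a combination
  is a function of the mutual distances alone.\<close>

lemma gvar_sum_zero:
  fixes p :: "'i::finite \<Rightarrow> 'a::real_inner"
  assumes "sum c UNIV = 0"
  shows "(norm (\<Sum>i\<in>UNIV. c i *\<^sub>R p i))\<^sup>2 = - gvar c p"
  using gvar_eq[of c p] assms by simp

lemma gvar_nonneg: "(\<And>i. 0 \<le> l i) \<Longrightarrow> 0 \<le> gvar l p"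
  unfolding gvar_def by (auto intro!: sum_nonneg)

text \<open>Compares \<open>gvar\<close> with its value for a simplex all of whose squared edges are
  \<open>M\<close>. The diagonal carries no edge; its share reappears as the sum of squared
  weights.\<close>

lemma gvar_deviation:
  fixes p :: "'i::finite \<Rightarrow> 'a::real_inner"
  shows "(\<Sum>i\<in>UNIV. \<Sum>j\<in>UNIV. l i * l j * (if i = j then 0 else M - (norm (p i - p j))\<^sup>2))
    = M * ((sum l UNIV)\<^sup>2 - (\<Sum>i\<in>UNIV. (l i)\<^sup>2)) - 2 * gvar l p"
proof -
  have "(\<Sum>i\<in>UNIV. \<Sum>j\<in>UNIV. l i * l j * (if i = j then 0 else M - (norm (p i - p j))\<^sup>2))
      = (\<Sum>i\<in>UNIV. \<Sum>j\<in>UNIV. M * (l i * l j) - (if i = j then M * (l i)\<^sup>2 else 0) - l i * l j * (norm (p i - p j))\<^sup>2)"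
    by (intro sum.cong refl) (auto simp: algebra_simps power2_eq_square)
  also have "\<dots> = M * (\<Sum>i\<in>UNIV. \<Sum>j\<in>UNIV. l i * l j) - M * (\<Sum>i\<in>UNIV. (l i)\<^sup>2) - 2 * gvar l p"
    by (simp add: sum_subtractf gvar_def flip: sum_distrib_left)
  finally show ?thesis by (simp add: power2_eq_square sum_product algebra_simps)
qed

lemma gvar_regular:
  fixes p :: "'i::finite \<Rightarrow> 'a::real_inner"
  assumes "\<And>i j. i \<noteq> j \<Longrightarrow> (norm (p i - p j))\<^sup>2 = 4"
  shows "gvar (\<lambda>_. 1 / real CARD('i)) p = 2 * (1 - 1 / real CARD('i))"
proof -
  have "(\<Sum>i\<in>UNIV. \<Sum>j\<in>UNIV. 1 / real CARD('i) * (1 / real CARD('i))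
      * (if i = j then 0 else 4 - (norm (p i - p j))\<^sup>2)) = 0"
    using assms by (intro sum.neutral ballI) auto
  thus ?thesis
    using gvar_deviation[of "\<lambda>_. 1 / real CARD('i)" 4 p] by (simp add: power2_eq_square)
qed

lemma sum_sq_dev_mean:
  fixes l :: "'i::finite \<Rightarrow> real"
  assumes "sum l UNIV = 1"
  shows "(\<Sum>i\<in>UNIV. (l i - 1 / real CARD('i))\<^sup>2) = (\<Sum>i\<in>UNIV. (l i)\<^sup>2) - 1 / real CARD('i)"
proof -
  let ?N = "real CARD('i)"
  have "(\<Sum>i\<in>UNIV. (l i - 1 / ?N)\<^sup>2) = (\<Sum>i\<in>UNIV. (l i)\<^sup>2 - (2 / ?N) * l i + (1 / ?N)\<^sup>2)"
    by (intro sum.cong refl) (simp add: power2_diff)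
  also have "\<dots> = (\<Sum>i\<in>UNIV. (l i)\<^sup>2) - (2 / ?N) * 1 + ?N * (1 / ?N)\<^sup>2"
    unfolding sum.distrib sum_subtractf assms[symmetric] sum_distrib_left by simp
  finally show ?thesis by (simp add: power2_eq_square field_simps)
qed

text \<open>The variance side of Jung's theorem: the edge defects in \<open>gvar_deviation\<close>
  are nonnegative, and the sum of squared weights is smallest, namely 1/N, for equal
  weights.\<close>

lemma gvar_le:
  fixes p :: "'i::finite \<Rightarrow> 'a::real_inner"
  assumes l: "\<And>i. 0 \<le> l i" "sum l UNIV = 1" and M: "0 \<le> M"
    and p: "\<And>i j. i \<noteq> j \<Longrightarrow> (norm (p i - p j))\<^sup>2 \<le> M"
  shows "gvar l p \<le> M / 2 * (1 - 1 / real CARD('i))"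
proof -
  have "0 \<le> (\<Sum>i\<in>UNIV. \<Sum>j\<in>UNIV. l i * l j * (if i = j then 0 else M - (norm (p i - p j))\<^sup>2))"
    using l p by (auto intro!: sum_nonneg mult_nonneg_nonneg)
  hence "2 * gvar l p \<le> M * (1 - (\<Sum>i\<in>UNIV. (l i)\<^sup>2))"
    by (simp add: gvar_deviation l)
  also have "(\<Sum>i\<in>UNIV. (l i)\<^sup>2) \<ge> 1 / real CARD('i)"
    using sum_sq_dev_mean[OF l(2)] sum_nonneg[of UNIV "\<lambda>i. (l i - 1 / real CARD('i))\<^sup>2"] by simp
  hence "M * (1 - (\<Sum>i\<in>UNIV. (l i)\<^sup>2)) \<le> M * (1 - 1 / real CARD('i))"
    using M by (intro mult_left_mono) auto
  finally show ?thesis by simp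
qed

text \<open>Stability of Jung's bound: almost maximal variance forces almost equal weights and
  leaves a total weighted defect of at most \<open>e\<close>; as no weight is small, each single
  defect is small.\<close>

lemma edges_ge:
  fixes p :: "'i::finite \<Rightarrow> 'a::real_inner"
  defines "N \<equiv> real CARD('i)"
  assumes l: "\<And>i. 0 \<le> l i" "sum l UNIV = 1"
    and g: "gvar l p \<ge> 2 * (1 - 1 / N)" and e: "0 \<le> e" "e * N\<^sup>2 \<le> 1"
    and p: "\<And>i j. i \<noteq> j \<Longrightarrow> (norm (p i - p j))\<^sup>2 \<le> 4 + e" and ij: "i \<noteq> j"
  shows "(norm (p i - p j))\<^sup>2 \<ge> 4 - 4 * N\<^sup>2 * e"
proof -
  let ?L = "\<Sum>i\<in>UNIV. (l i)\<^sup>2"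
  let ?D = "\<lambda>i j. l i * l j * (if i = j then 0 else 4 + e - (norm (p i - p j))\<^sup>2)"
  have N: "N \<ge> 1" unfolding N_def by (simp add: Suc_leI)
  have D: "0 \<le> ?D i j" for i j using l p by auto
  have sumD: "(\<Sum>i\<in>UNIV. \<Sum>j\<in>UNIV. ?D i j) = (4 + e) * (1 - ?L) - 2 * gvar l p"
    by (simp add: gvar_deviation l)
  have dev: "(\<Sum>i\<in>UNIV. (l i - 1 / N)\<^sup>2) = ?L - 1 / N"
    unfolding N_def by (rule sum_sq_dev_mean[OF l(2)])
  hence L: "?L \<ge> 1 / N" using sum_nonneg[of UNIV "\<lambda>i. (l i - 1 / N)\<^sup>2"] by simp
  have "0 \<le> (4 + e) * (1 - ?L) - 2 * gvar l p"
    unfolding sumD[symmetric] using D by (intro sum_nonneg) auto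
  hence "4 * (1 - 1 / N) \<le> (4 + e) * (1 - ?L)" using g by linarith
  also have "\<dots> \<le> 4 * (1 - ?L) + e"
    using e(1) L N sum_nonneg[of UNIV "\<lambda>i. (l i)\<^sup>2"] mult_left_mono[of "1 - ?L" 1 e]
    by (simp add: algebra_simps)
  finally have Le: "?L - 1 / N \<le> e / 4" by simp
  \<comment> \<open>Each squared deviation of a weight from 1/N is at most \<open>e / 4\<close>, and
    \<open>e * N\<^sup>2 \<le> 1\<close> turns this into a deviation of at most half of 1/N.\<close>
  have low: "l i \<ge> 1 / (2 * N)" for i
  proof -
    have "(l i - 1 / N)\<^sup>2 \<le> (\<Sum>i\<in>UNIV. (l i - 1 / N)\<^sup>2)"
      by (rule member_le_sum) auto
    also have "\<dots> \<le> e / 4" using dev Le by simp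
    also have "\<dots> \<le> (1 / (2 * N))\<^sup>2" using e(2) N by (simp add: field_simps power2_eq_square)
    finally have "\<bar>l i - 1 / N\<bar> \<le> 1 / (2 * N)"
      using N by (simp add: abs_le_square_iff[symmetric])
    hence "1 / N - 1 / (2 * N) \<le> l i" by linarith
    thus ?thesis using N by (simp add: field_simps)
  qed
  have "?D i j \<le> (\<Sum>j\<in>UNIV. ?D i j)" using D by (intro member_le_sum) auto
  also have "\<dots> \<le> (\<Sum>i\<in>UNIV. \<Sum>j\<in>UNIV. ?D i j)"
    using D by (intro member_le_sum[of i UNIV "\<lambda>i. \<Sum>j\<in>UNIV. ?D i j"] sum_nonneg) auto
  also have "\<dots> \<le> (4 + e) * (1 - 1 / N) - 4 * (1 - 1 / N)"
    unfolding sumD using g L mult_left_mono[of "1 - ?L" "1 - 1/N" "4 + e"] e by linarith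
  also have "\<dots> \<le> e" using e N mult_left_mono[of "1 - 1/N" 1 e] by (simp add: algebra_simps)
  finally have DE: "l i * l j * (4 + e - (norm (p i - p j))\<^sup>2) \<le> e" using ij by simp
  have "1 / (2 * N) * (1 / (2 * N)) * (4 + e - (norm (p i - p j))\<^sup>2) \<le> l i * l j * (4 + e - (norm (p i - p j))\<^sup>2)"
    using low N p[OF ij] l by (intro mult_right_mono mult_mono) auto
  hence "1 / (2 * N) * (1 / (2 * N)) * (4 + e - (norm (p i - p j))\<^sup>2) \<le> e"
    using DE by linarith
  hence "4 + e - (norm (p i - p j))\<^sup>2 \<le> 4 * N\<^sup>2 * e"
    using N by (simp add: field_simps power2_eq_square)
  thus ?thesis using e by linarith
qed

text \<open>At a maximizer of \<open>gvar\<close> over the weights, with barycentre \<open>z\<close>, shifting weight towards \<open>k\<close> cannot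
  increase \<open>gvar\<close>, and to first order this says \<open>norm (p k - z) ^ 2 \<le> gvar\<close>.\<close>

lemma jung_dual:
  fixes p :: "'i::finite \<Rightarrow> 'a::real_inner"
  assumes no: "\<And>z. \<exists>i. norm (p i - z) > \<rho>" and \<rho>: "\<rho> \<ge> 0"
  obtains l where "\<And>i. 0 \<le> l i" "sum l UNIV = 1" "gvar l p > \<rho>\<^sup>2"
proof -
  let ?D = "{l :: real^'i. (\<forall>i. 0 \<le> l$i) \<and> (\<Sum>i\<in>UNIV. l$i) = 1}"
  have "compact ?D"
  proof -
    have "?D = {l. \<forall>i. 0 \<le> l$i} \<inter> {l. (\<Sum>i\<in>UNIV. l$i) = 1}" by auto
    moreover have "closed {l :: real^'i. \<forall>i. 0 \<le> l$i}"
      by (intro closed_Collect_all closed_Collect_le continuous_intros)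
    moreover have "closed {l :: real^'i. (\<Sum>i\<in>UNIV. l$i) = 1}"
      by (intro closed_Collect_eq continuous_intros)
    moreover have "bounded ?D"
    proof (rule boundedI)
      fix l assume l: "l \<in> ?D"
      have "norm l \<le> (\<Sum>i\<in>UNIV. \<bar>l$i\<bar>)" by (rule norm_le_l1_cart)
      also have "\<dots> = 1" using l by simp
      finally show "norm l \<le> 1" .
    qed
    ultimately show ?thesis by (metis (no_types, lifting) closed_Int compact_eq_bounded_closed)
  qed
  moreover have "axis (undefined::'i) 1 \<in> ?D" by (auto simp: axis_def)
  moreover have "continuous_on ?D (\<lambda>l. gvar (\<lambda>i. l$i) p)"
    unfolding gvar_def by (intro continuous_intros) auto
  ultimately obtain l where l: "l \<in> ?D" and mx: "\<And>m. m \<in> ?D \<Longrightarrow> gvar (\<lambda>i. m$i) p \<le> gvar (\<lambda>i. l$i) p"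
    using continuous_attains_sup[of ?D "\<lambda>l. gvar (\<lambda>i. l$i) p"] by blast
  define G where "G = gvar (\<lambda>i. l$i) p"
  define z where "z = (\<Sum>i\<in>UNIV. l$i *\<^sub>R p i)"
  have G0: "G \<ge> 0" unfolding G_def using l by (intro gvar_nonneg) auto
  have bd: "(norm (p k - z))\<^sup>2 \<le> G" for k
  proof (rule ccontr)
    let ?A = "(norm (p k - z))\<^sup>2"
    assume "\<not> ?A \<le> G"
    hence AG: "?A > G" by simp
    \<comment> \<open>Maximizer of \<open>G + t * (?A - G) - t\<^sup>2 * ?A\<close>, the variance
      after moving the fraction \<open>t\<close> of the weight to \<open>k\<close>.\<close>
    define t where "t = (?A - G) / (2 * ?A)"
    have A0: "?A > 0" using AG G0 by linarith
    have t: "0 < t" "t \<le> 1" using AG G0 A0 unfolding t_def by (simp, subst divide_le_eq_1_pos) auto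
    have t3: "t * ?A = (?A - G) / 2" using A0 unfolding t_def by (metis less_irrefl mult.commute nonzero_divide_mult_cancel_left times_divide_eq_left mult_divide_mult_cancel_right)
    define m where "m = (\<chi> i. (1 - t) * l$i + (if i = k then t else 0))"
    have sm: "(\<Sum>i\<in>UNIV. m$i) = 1"
      using l by (simp add: m_def sum.distrib flip: sum_distrib_left)
    have mD: "m \<in> ?D" using l t sm by (auto simp: m_def)
    have zt: "(\<Sum>i\<in>UNIV. m$i *\<^sub>R p i) = (1 - t) *\<^sub>R z + t *\<^sub>R p k"
      by (simp add: m_def z_def scaleR_add_left sum.distrib scaleR_sum_right if_distrib[of "\<lambda>x. x *\<^sub>R _"] cong: if_cong)
    have "(\<Sum>i\<in>UNIV. m$i * (norm (p i - z))\<^sup>2)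
        = (1 - t) * (\<Sum>i\<in>UNIV. l$i * (norm (p i - z))\<^sup>2) + t * ?A"
      by (simp add: m_def distrib_right sum.distrib sum_distrib_left mult.assoc if_distrib[of "\<lambda>x. x * _"] cong: if_cong)
    also have "(\<Sum>i\<in>UNIV. l$i * (norm (p i - z))\<^sup>2) = G"
      using sum_weighted_dist_sq[of "\<lambda>i. l$i" p z] l by (simp add: G_def z_def)
    finally have "gvar (\<lambda>i. m$i) p = (1 - t) * G + t * ?A - (norm ((1 - t) *\<^sub>R z + t *\<^sub>R p k - z))\<^sup>2"
      using sum_weighted_dist_sq[of "\<lambda>i. m$i" p z] sm zt by simp
    also have "(1 - t) *\<^sub>R z + t *\<^sub>R p k - z = t *\<^sub>R (p k - z)" by (simp add: algebra_simps)
    also have "(norm \<dots>)\<^sup>2 = t * (t * ?A)" by (simp add: power_mult_distrib power2_eq_square)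
    also have "\<dots> = t * ((?A - G) / 2)" by (simp only: t3)
    finally have "gvar (\<lambda>i. m$i) p = G + t * (?A - G) / 2"
      by (simp add: field_simps)
    moreover have "t * (?A - G) > 0" using t AG by simp
    ultimately show False using mx[OF mD] by (simp add: G_def)
  qed
  obtain k where "norm (p k - z) > \<rho>" using no by blast
  hence "\<rho>\<^sup>2 < (norm (p k - z))\<^sup>2" using \<rho> by (intro power_strict_mono) auto
  hence "gvar (\<lambda>i. l$i) p > \<rho>\<^sup>2" using bd[of k] by (simp add: G_def)
  thus ?thesis using l that[of "\<lambda>i. l$i"] by simp
qed

text \<open>A centre of a ball containing \<open>S\<close> is a common point of the balls of the
  same radius around the points of \<open>S\<close>, so Helly applies to those, with compactness for
  infinite \<open>S\<close>.\<close>

lemma helly_balls: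
  fixes S :: "'a::euclidean_space set"
  assumes card: "CARD('i::finite) = DIM('a) + 1"
    and q: "\<And>q :: 'i \<Rightarrow> 'a. range q \<subseteq> S \<Longrightarrow> \<exists>z. \<forall>i. norm (q i - z) \<le> \<rho>"
  shows "\<exists>z. \<forall>x\<in>S. norm (x - z) \<le> \<rho>"
proof -
  let ?F = "(\<lambda>x. cball x \<rho>) ` S"
  have small: "\<Inter>t \<noteq> {}" if t: "t \<subseteq> ?F" "finite t" "card t \<le> DIM('a) + 1" for t
  proof (cases "t = {}")
    case False
    obtain B where B: "B \<subseteq> S" "inj_on (\<lambda>x. cball x \<rho>) B" "t = (\<lambda>x. cball x \<rho>) ` B"
      using t(1) by (auto simp: subset_image_inj)
    have fB: "finite B" "card B \<le> CARD('i)" "B \<noteq> {}"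
      using B t card False by (auto simp: finite_image_iff card_image)
    then obtain f :: "'a \<Rightarrow> 'i" where f: "inj_on f B" using card_le_inj[of B "UNIV :: 'i set"] by auto
    have inv: "inv_into B f ` UNIV \<supseteq> B" using f by (metis UNIV_I image_eqI inv_into_f_f subsetI)
    obtain b where b: "b \<in> B" using fB by auto
    \<comment> \<open>For fewer than d + 1 balls the tuple is filled up by repeating the point
      \<open>b\<close>.\<close>
    define q where "q = (\<lambda>i. if i \<in> f ` B then inv_into B f i else b)"
    have "range q \<subseteq> B" using b by (auto simp: q_def inv_into_into)
    then obtain z where z: "\<forall>i. norm (q i - z) \<le> \<rho>" using q B(1) by (meson subset_trans)
    have "norm (x - z) \<le> \<rho>" if "x \<in> B" for x
      using z[rule_format, of "f x"] that f by (simp add: q_def)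
    hence "z \<in> \<Inter>t" unfolding B(3) by (auto simp: dist_norm)
    thus ?thesis by blast
  qed auto
  have "\<Inter>?F \<noteq> {}"
  proof (rule compact_fip_Heine_Borel)
    fix F' assume F': "finite F'" "F' \<subseteq> ?F"
    show "\<Inter>F' \<noteq> {}"
    proof (cases "card F' \<le> DIM('a) + 1")
      case True thus ?thesis using small F' by blast
    next
      case False
      show ?thesis
      proof (rule Helly)
        show "card F' \<ge> DIM('a) + 1" using False by simp
        show "\<forall>s\<in>F'. convex s" using F' by auto
        show "\<And>t. t \<subseteq> F' \<Longrightarrow> card t = DIM('a) + 1 \<Longrightarrow> \<Inter>t \<noteq> {}"
          using small F' by (metis finite_subset order_refl subset_trans)
      qed
    qed
  qed auto
  then obtain z where "z \<in> \<Inter>?F" by blast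
  thus ?thesis by (auto simp: dist_norm)
qed

section \<open>Almost regular simplices\<close>

text \<open>A regular simplex gives exactly twice the sum of squares. By Cauchy-Schwarz an error
  \<open>k\<close> in the squared edges changes this by at most half, since
  \<open>k * N \<le> 2\<close>.\<close>

lemma lincomb_lower_bound:
  fixes p :: "'i::finite \<Rightarrow> 'a::real_inner"
  assumes c: "sum c UNIV = 0" and k: "k * real CARD('i) \<le> 2"
    and p: "\<And>i j. i \<noteq> j \<Longrightarrow> \<bar>(norm (p i - p j))\<^sup>2 - 4\<bar> \<le> k"
  shows "(\<Sum>i\<in>UNIV. (c i)\<^sup>2) \<le> (norm (\<Sum>i\<in>UNIV. c i *\<^sub>R p i))\<^sup>2"
proof (cases "\<exists>i j :: 'i. i \<noteq> j")
  case False
  hence U: "(UNIV :: 'i set) = {undefined}" by blast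
  show ?thesis using c unfolding U by simp
next
  case True
  hence k0: "k \<ge> 0" using p by (meson abs_ge_zero order_trans)
  let ?D = "\<Sum>i\<in>UNIV. \<Sum>j\<in>UNIV. c i * c j * (if i = j then 0 else 4 - (norm (p i - p j))\<^sup>2)"
  have "\<bar>?D\<bar> \<le> (\<Sum>i\<in>UNIV. \<Sum>j\<in>UNIV. \<bar>c i * c j * (if i = j then 0 else 4 - (norm (p i - p j))\<^sup>2)\<bar>)"
    by (rule order_trans[OF sum_abs sum_mono[OF sum_abs]])
  also have "\<dots> \<le> (\<Sum>i\<in>UNIV. \<Sum>j\<in>UNIV. \<bar>c i\<bar> * \<bar>c j\<bar> * k)"
    using p k0 by (intro sum_mono) (auto simp: abs_mult abs_minus_commute intro!: mult_left_mono)
  also have "\<dots> = k * (\<Sum>i\<in>UNIV. \<bar>c i\<bar>)\<^sup>2"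
    by (simp add: power2_eq_square sum_product sum_distrib_left mult_ac)
  also have "\<dots> \<le> k * ((\<Sum>i\<in>UNIV. (c i)\<^sup>2) * real CARD('i))"
    using sum_squared_le_sum_of_squares[of "\<lambda>i. \<bar>c i\<bar>" UNIV] k0 by (intro mult_left_mono) auto
  also have "\<dots> = (k * real CARD('i)) * (\<Sum>i\<in>UNIV. (c i)\<^sup>2)" by simp
  also have "\<dots> \<le> 2 * (\<Sum>i\<in>UNIV. (c i)\<^sup>2)"
    using k by (intro mult_right_mono sum_nonneg) auto
  finally have "\<bar>?D\<bar> \<le> 2 * (\<Sum>i\<in>UNIV. (c i)\<^sup>2)" .
  moreover have "?D = - 4 * (\<Sum>i\<in>UNIV. (c i)\<^sup>2) - 2 * gvar c p"
    using gvar_deviation[of c 4 p] c by simp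
  ultimately show ?thesis using gvar_sum_zero[OF c, of p] by linarith
qed

lemma regular_lincomb_sq:
  fixes p :: "'i::finite \<Rightarrow> 'a::real_inner"
  assumes c: "sum c UNIV = 0" and p: "\<And>i j. i \<noteq> j \<Longrightarrow> (norm (p i - p j))\<^sup>2 = 4"
  shows "(norm (\<Sum>i\<in>UNIV. c i *\<^sub>R p i))\<^sup>2 = 2 * (\<Sum>i\<in>UNIV. (c i)\<^sup>2)"
proof -
  have "(\<Sum>i\<in>UNIV. \<Sum>j\<in>UNIV. c i * c j * (if i = j then 0 else 4 - (norm (p i - p j))\<^sup>2)) = 0"
    using p by (intro sum.neutral ballI) auto
  thus ?thesis using gvar_deviation[of c 4 p] c gvar_sum_zero[OF c, of p] by simp
qed

text \<open>The map from coefficients to their combination and sum is injective by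
  \<open>lincomb_lower_bound\<close>, between spaces of dimension d + 1, hence onto.
  \<open>s = 1\<close> gives barycentric coordinates, \<open>s = 0\<close> expansions in edge
  vectors.\<close>

lemma affine_coordinates_exist:
  fixes p :: "'i::finite \<Rightarrow> 'a::euclidean_space"
  assumes card: "CARD('i) = DIM('a) + 1" and k: "k * real CARD('i) \<le> 2"
    and p: "\<And>i j. i \<noteq> j \<Longrightarrow> \<bar>(norm (p i - p j))\<^sup>2 - 4\<bar> \<le> k"
  obtains c where "sum c UNIV = s" "(\<Sum>i\<in>UNIV. c i *\<^sub>R p i) = x"
proof -
  define f where "f = (\<lambda>c :: real^'i. ((\<Sum>i\<in>UNIV. c$i *\<^sub>R p i), (\<Sum>i\<in>UNIV. c$i)))"
  have lin: "linear f"
    unfolding f_def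
    by (intro linearI) (auto simp: algebra_simps sum.distrib scaleR_sum_right sum_distrib_left)
  have inj: "inj f"
  proof (subst linear_injective_0[OF lin], intro allI impI)
    fix c assume "f c = 0"
    hence "(\<Sum>i\<in>UNIV. c$i *\<^sub>R p i) = 0" "(\<Sum>i\<in>UNIV. c$i) = 0" by (auto simp: f_def zero_prod_def)
    hence "(\<Sum>i\<in>UNIV. (c$i)\<^sup>2) \<le> 0" using lincomb_lower_bound[of "\<lambda>i. c$i" k p] k p by simp
    hence "\<forall>i. c$i = 0"
      using sum_nonneg_eq_0_iff[of UNIV "\<lambda>i. (c$i)\<^sup>2"] by (simp add: order_antisym sum_nonneg)
    thus "c = 0" by (simp add: vec_eq_iff)
  qed
  have "dim (f ` UNIV) = dim (UNIV :: (real^'i) set)"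
    using inj by (intro dim_image_eq[OF lin]) (auto simp: inj_on_def)
  hence "dim (range f) = DIM('a \<times> real)" using card by simp
  hence "span (range f) = UNIV" using dim_eq_full[of "range f"] by (simp add: dim_UNIV)
  moreover have "span (range f) = range f"
    using linear_subspace_image[OF lin subspace_UNIV] by (simp add: span_eq_iff)
  ultimately obtain c where "f c = (x, s)" by (metis UNIV_I imageE)
  thus ?thesis using that[of "\<lambda>i. c$i"] by (auto simp: f_def)
qed

text \<open>Expand \<open>w\<close> in the edges at \<open>p i\<close>. The coefficients are at most
  \<open>norm w\<close>, so pairing the expansion with \<open>w\<close> and cancelling one factor
  \<open>norm w\<close> gives the bound.\<close>

lemma frame_bound:
  fixes p :: "'i::finite \<Rightarrow> 'a::euclidean_space"
  assumes card: "CARD('i) = DIM('a) + 1" and k: "k * real CARD('i) \<le> 2"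
    and p: "\<And>i j. i \<noteq> j \<Longrightarrow> \<bar>(norm (p i - p j))\<^sup>2 - 4\<bar> \<le> k"
    and M: "\<And>j. \<bar>w \<bullet> (p i - p j)\<bar> \<le> M"
  shows "norm w \<le> real CARD('i) * M"
proof -
  obtain c where c: "sum c UNIV = 0" "(\<Sum>i\<in>UNIV. c i *\<^sub>R p i) = w"
    using affine_coordinates_exist[where p = p and s = 0 and x = w, OF card k p] .
  have "(\<Sum>i\<in>UNIV. (c i)\<^sup>2) \<le> (norm w)\<^sup>2" using lincomb_lower_bound[OF c(1) k, of p, OF p] c(2) by simp
  hence "(c j)\<^sup>2 \<le> (norm w)\<^sup>2" for j
    using order_trans[OF member_le_sum[of j UNIV "\<lambda>i. (c i)\<^sup>2"]] by simp
  hence cw: "\<bar>c j\<bar> \<le> norm w" for j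
    by (metis abs_le_square_iff abs_norm_cancel)
  have "w = (\<Sum>j\<in>UNIV. c j *\<^sub>R (p j - p i))"
    using c by (simp add: scaleR_diff_right sum_subtractf flip: scaleR_left.sum)
  hence "w \<bullet> w = w \<bullet> (\<Sum>j\<in>UNIV. c j *\<^sub>R (p j - p i))" by simp
  hence "(norm w)\<^sup>2 = (\<Sum>j\<in>UNIV. c j * (w \<bullet> (p j - p i)))"
    by (simp only: inner_sum_right inner_scaleR_right power2_norm_eq_inner)
  also have "\<dots> \<le> (\<Sum>j\<in>(UNIV::'i set). norm w * M)"
  proof (rule sum_mono)
    fix j
    have "\<bar>w \<bullet> (p j - p i)\<bar> \<le> M" using M[of j] by (simp add: inner_diff_right abs_minus_commute)
    hence "\<bar>c j\<bar> * \<bar>w \<bullet> (p j - p i)\<bar> \<le> norm w * M" using cw by (intro mult_mono) auto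
    thus "c j * (w \<bullet> (p j - p i)) \<le> norm w * M" by (metis abs_ge_self abs_mult order_trans)
  qed
  also have "\<dots> = norm w * (real CARD('i) * M)" by simp
  finally have *: "norm w * norm w \<le> norm w * (real CARD('i) * M)" by (simp add: power2_eq_square)
  have "M \<ge> 0" using M[of i] by simp
  thus ?thesis using * by (cases "w = 0") (auto simp: mult_le_cancel_left)
qed

section \<open>Rigidity of regular simplices\<close>

text \<open>In barycentric coordinates \<open>b\<close> of \<open>x\<close> the hypothesis reads \<open>\<Sum>b\<^sup>2 - 2 b\<^sub>j \<le> 1\<close>. If \<open>\<Sum>b\<^sup>2\<close> exceeded 1,
  all coordinates would be positive with sum 1, which forces \<open>\<Sum>b\<^sup>2 \<le> 1\<close>.\<close>

lemma reuleaux_simplex: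
  fixes p :: "'i::finite \<Rightarrow> 'a::euclidean_space"
  defines "N \<equiv> real CARD('i)"
  defines "z \<equiv> \<Sum>i\<in>UNIV. (1 / N) *\<^sub>R p i"
  assumes card: "CARD('i) = DIM('a) + 1"
    and p: "\<And>i j. i \<noteq> j \<Longrightarrow> (norm (p i - p j))\<^sup>2 = 4"
    and x: "\<And>j. (norm (x - p j))\<^sup>2 \<le> 4"
  shows "(norm (x - z))\<^sup>2 \<le> 2 * (1 - 1 / N)"
    and "(norm (x - z))\<^sup>2 = 2 * (1 - 1 / N) \<Longrightarrow> x \<in> range p"
proof -
  obtain b where b: "sum b UNIV = 1" "(\<Sum>i\<in>UNIV. b i *\<^sub>R p i) = x"
    using affine_coordinates_exist[OF card, of 0 p 1 x] p by auto
  let ?S = "\<Sum>i\<in>UNIV. (b i)\<^sup>2"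
  have "sum (\<lambda>i. b i - 1 / N) UNIV = 0" using b by (simp add: sum_subtractf N_def)
  from regular_lincomb_sq[OF this, of p, OF p]
  have xz: "(norm (x - z))\<^sup>2 = 2 * (?S - 1 / N)"
    using b sum_sq_dev_mean[OF b(1)] by (simp add: scaleR_diff_left sum_subtractf z_def N_def)
  have bj: "?S - 2 * b j \<le> 1" for j
  proof -
    have "sum (\<lambda>i. b i - of_bool (i = j)) UNIV = 0" using b by (simp add: sum_subtractf)
    from regular_lincomb_sq[OF this, of p, OF p]
    moreover have "(\<Sum>i\<in>UNIV. of_bool (i = j) *\<^sub>R p i) = p j"
      by (simp add: of_bool_def if_distrib[of "\<lambda>x. x *\<^sub>R _"] cong: if_cong)
    ultimately have "(norm (x - p j))\<^sup>2 = 2 * (\<Sum>i\<in>UNIV. (b i - of_bool (i = j))\<^sup>2)"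
      using b by (simp add: scaleR_diff_left sum_subtractf)
    also have "(\<Sum>i\<in>UNIV. (b i - of_bool (i = j))\<^sup>2) = (\<Sum>i\<in>UNIV. (b i)\<^sup>2 + of_bool (i = j) * (1 - 2 * b i))"
      by (intro sum.cong) (auto simp: power2_diff)
    also have "\<dots> = ?S + 1 - 2 * b j" by (simp add: sum.distrib)
    finally show ?thesis using x[of j] by simp
  qed
  have le: "b j \<le> 1" if "\<And>i. b i \<ge> 0" for j
    using member_le_sum[of j UNIV b] that b by simp
  have S: "?S \<le> 1"
  proof (rule ccontr)
    assume *: "\<not> ?S \<le> 1"
    hence pos: "b j \<ge> 0" for j using bj[of j] by linarith
    have "?S \<le> sum b UNIV"
      using pos le[OF pos] by (intro sum_mono) (simp add: power2_eq_square mult_left_le)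
    with * b show False by simp
  qed
  show "(norm (x - z))\<^sup>2 \<le> 2 * (1 - 1 / N)" using xz S by simp
  show "x \<in> range p" if "(norm (x - z))\<^sup>2 = 2 * (1 - 1 / N)"
  proof -
    have S1: "?S = 1" using that xz by simp
    hence pos: "b j \<ge> 0" for j using bj[of j] by linarith
    \<comment> \<open>Coordinates between 0 and 1 whose sum equals their sum of squares are all 0 or
      1.\<close>
    have "(\<Sum>i\<in>UNIV. b i * (1 - b i)) = 0"
      using S1 b by (simp add: right_diff_distrib sum_subtractf power2_eq_square)
    hence "\<forall>i. b i * (1 - b i) = 0"
      using sum_nonneg_eq_0_iff[of UNIV "\<lambda>i. b i * (1 - b i)"] pos le[OF pos] by simp
    hence 01: "b i = 0 \<or> b i = 1" for i by auto
    obtain j where j: "b j \<noteq> 0" using b by (metis sum.neutral zero_neq_one)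
    have "b i = 0" if "i \<noteq> j" for i
    proof -
      have "b i + b j = sum b {i, j}" using that by simp
      also have "\<dots> \<le> sum b UNIV" using pos by (intro sum_mono2) auto
      finally show ?thesis using 01[of i] 01[of j] j b by auto
    qed
    hence "(\<Sum>i\<in>UNIV. b i *\<^sub>R p i) = (\<Sum>i\<in>UNIV. if i = j then p i else 0)"
      using 01[of j] j by (intro sum.cong) auto
    hence "x = p j" using b by simp
    thus ?thesis by simp
  qed
qed

text \<open>Every \<open>q i\<close> lies in the circumball of \<open>p\<close> by
  \<open>reuleaux_simplex\<close>. The mean squared distance of the \<open>q i\<close> from its
  centre is at least their variance, which equals the squared radius, so the equality case holds for
  all of them.\<close>

lemma regular_simplices_coincide:
  fixes p q :: "'i::finite \<Rightarrow> 'a::euclidean_space"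
  assumes card: "CARD('i) = DIM('a) + 1"
    and p: "\<And>i j. i \<noteq> j \<Longrightarrow> (norm (p i - p j))\<^sup>2 = 4"
    and q: "\<And>i j. i \<noteq> j \<Longrightarrow> (norm (q i - q j))\<^sup>2 = 4"
    and pq: "\<And>i j. (norm (q i - p j))\<^sup>2 \<le> 4"
  shows "q i \<in> range p"
proof -
  define N where "N = real CARD('i)"
  define z where "z = (\<Sum>i\<in>UNIV. (1 / N) *\<^sub>R p i)"
  have N: "N > 0" by (simp add: N_def)
  have le: "(norm (q i - z))\<^sup>2 \<le> 2 * (1 - 1 / N)" for i
    using reuleaux_simplex(1)[OF card, of p "q i", OF p pq] by (simp add: z_def N_def)
  have sN: "(\<Sum>i\<in>(UNIV::'i set). 1 / N) = 1" by (simp add: N_def)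
  have "gvar (\<lambda>_. 1 / N) q = 2 * (1 - 1 / N)" unfolding N_def using q by (rule gvar_regular)
  hence "(\<Sum>i\<in>UNIV. 1 / N * (norm (q i - z))\<^sup>2) \<ge> 2 * (1 - 1 / N)"
    using sum_weighted_dist_sq[OF sN, of q z] by simp
  moreover define C where "C = 2 * (1 - 1 / N)"
  ultimately have "C \<le> (\<Sum>i\<in>UNIV. (norm (q i - z))\<^sup>2) / N"
    by (simp add: sum_divide_distrib)
  hence "(\<Sum>i\<in>UNIV. (norm (q i - z))\<^sup>2) \<ge> C * N"
    using N by (simp only: pos_le_divide_eq)
  hence "(\<Sum>i\<in>UNIV. C - (norm (q i - z))\<^sup>2) \<le> 0"
    by (simp add: sum_subtractf N_def mult.commute)
  moreover have nn: "0 \<le> C - (norm (q i - z))\<^sup>2" for i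
    using le[of i] by (simp add: C_def)
  ultimately have "\<forall>i. C - (norm (q i - z))\<^sup>2 = 0"
    using sum_nonneg_eq_0_iff[of UNIV "\<lambda>i. C - (norm (q i - z))\<^sup>2"]
    by (simp add: order_antisym sum_nonneg)
  hence "(norm (q i - z))\<^sup>2 = 2 * (1 - 1 / N)" by (simp add: C_def)
  thus ?thesis
    using reuleaux_simplex(2)[OF card, of p "q i", OF p pq] by (simp add: z_def N_def)
qed

text \<open>Compactness version of \<open>regular_simplices_coincide\<close>: configurations in
  which some \<open>q i\<close> stays \<open>\<eta>\<close>-far from \<open>p\<close> form a compact
  set, on which the total defect is continuous and positive, hence at least some
  \<open>m > 0\<close>.\<close>

lemma near_regular_simplices_match:
  fixes \<eta> :: real
  assumes card: "CARD('i::finite) = DIM('a::euclidean_space) + 1" and \<eta>: "\<eta> > 0"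
  obtains k where "k > 0"
    "\<And>(p :: 'i \<Rightarrow> 'a) (q :: 'i \<Rightarrow> 'a) i. \<lbrakk>\<And>i j. i \<noteq> j \<Longrightarrow> \<bar>(norm (p i - p j))\<^sup>2 - 4\<bar> \<le> k;
       \<And>i j. i \<noteq> j \<Longrightarrow> \<bar>(norm (q i - q j))\<^sup>2 - 4\<bar> \<le> k;
       \<And>i j. (norm (q i - p j))\<^sup>2 \<le> 4 + k\<rbrakk> \<Longrightarrow> \<exists>j. norm (q i - p j) < \<eta>"
proof -
  let ?N = "real CARD('i)"
  \<comment> \<open>Translating \<open>q i\<close> to the origin makes the configurations bounded:
    squared distances to it are at most 5, which the radius 3 covers.\<close>
  define B where "B = {p :: 'a^'i. \<forall>j. norm (p$j) \<le> 3}"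
  define Y where "Y = (\<lambda>i. {(p, q). q$i = 0 \<and> (\<forall>j. \<eta> \<le> norm (p$j))} \<inter> (B \<times> B))"
  define X where "X = (\<Union>i. Y i)"
  define E where "E = (\<lambda>p :: 'a^'i. \<Sum>i\<in>UNIV. \<Sum>j\<in>UNIV. if i = j then 0 else \<bar>(norm (p$i - p$j))\<^sup>2 - 4\<bar>)"
  define F where "F = (\<lambda>(p, q). E p + E q + (\<Sum>i\<in>UNIV. \<Sum>j\<in>UNIV. max 0 ((norm (q$i - p$j))\<^sup>2 - 4)))"
  have "closed B" unfolding B_def by (intro closed_Collect_all closed_Collect_le continuous_intros)
  moreover have "bounded B"
  proof (rule boundedI)
    fix p assume "p \<in> B"
    have "norm p \<le> (\<Sum>j\<in>UNIV. norm (p$j))" unfolding norm_vec_def by (rule L2_set_le_sum) auto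
    also have "\<dots> \<le> (\<Sum>j\<in>(UNIV::'i set). 3)" using \<open>p \<in> B\<close> by (intro sum_mono) (auto simp: B_def)
    finally show "norm p \<le> ?N * 3" by simp
  qed
  ultimately have "compact B" by (simp add: compact_eq_bounded_closed)
  hence "compact (B \<times> B)" by (simp add: compact_Times)
  moreover have "closed {(p :: 'a^'i, q :: 'a^'i). q$i = 0 \<and> (\<forall>j. \<eta> \<le> norm (p$j))}" for i
    unfolding case_prod_beta
    by (intro closed_Collect_conj closed_Collect_all closed_Collect_le closed_Collect_eq continuous_intros)
  ultimately have "compact (Y i)" for i unfolding Y_def by (rule closed_Int_compact[rotated])
  hence cX: "compact X" unfolding X_def by (intro compact_UN) auto
  have E0: "E p \<ge> 0" for p by (auto simp: E_def intro!: sum_nonneg)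
  have contE: "continuous_on UNIV E"
    unfolding E_def
  proof (intro continuous_on_sum)
    fix i j :: 'i
    show "continuous_on UNIV (\<lambda>p :: 'a^'i. if i = j then 0 else \<bar>(norm (p$i - p$j))\<^sup>2 - 4\<bar>)"
      by (cases "i = j") (auto intro!: continuous_intros)
  qed
  have contF: "continuous_on X F"
    unfolding F_def case_prod_beta
    by (intro continuous_intros continuous_on_compose2[OF contE]) auto
  have pos: "F x > 0" if xX: "x \<in> X" for x
  proof (rule ccontr)
    assume "\<not> F x > 0"
    obtain p q where pq: "x = (p, q)" by (cases x)
    then obtain i where x: "q$i = 0" "\<And>j. \<eta> \<le> norm (p$j)"
      using xX by (auto simp: X_def Y_def)
    define M where "M = (\<Sum>i\<in>UNIV. \<Sum>j\<in>UNIV. max 0 ((norm (q$i - p$j))\<^sup>2 - 4))"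
    have "0 \<le> M" unfolding M_def by (intro sum_nonneg) auto
    moreover have "F x = E p + E q + M" by (simp add: F_def pq M_def)
    ultimately have z: "E p = 0" "E q = 0" "M = 0"
      using \<open>\<not> F x > 0\<close> E0[of p] E0[of q] by linarith+
    have E: "(norm (p$i - p$j))\<^sup>2 = 4" if "E p = 0" "i \<noteq> j" for p i j
    proof -
      have "(\<Sum>j\<in>UNIV. if i = j then 0 else \<bar>(norm (p$i - p$j))\<^sup>2 - 4\<bar>) = 0"
        using that(1) unfolding E_def by (subst (asm) sum_nonneg_eq_0_iff) (auto intro!: sum_nonneg)
      hence "(if i = j then 0 else \<bar>(norm (p$i - p$j))\<^sup>2 - 4\<bar>) = 0"
        by (subst (asm) sum_nonneg_eq_0_iff) auto
      thus ?thesis using that(2) by simp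
    qed
    have "(norm (q$i - p$j))\<^sup>2 \<le> 4" for i j
    proof -
      have "(\<Sum>j\<in>UNIV. max 0 ((norm (q$i - p$j))\<^sup>2 - 4)) = 0"
        using z(3) unfolding M_def by (subst (asm) sum_nonneg_eq_0_iff) (auto intro!: sum_nonneg)
      hence "max 0 ((norm (q$i - p$j))\<^sup>2 - 4) = 0"
        by (subst (asm) sum_nonneg_eq_0_iff) auto
      thus ?thesis by (simp add: max_def split: if_splits)
    qed
    hence "q$i \<in> range (($) p)"
      using regular_simplices_coincide[OF card, of "($) p" "($) q" i] E[OF z(1)] E[OF z(2)] by blast
    then obtain j where "p$j = 0" using x(1) by auto
    thus False using x(2)[of j] \<eta> by simp
  qed
  obtain m where m: "m > 0" "\<And>x. x \<in> X \<Longrightarrow> m \<le> F x"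
  proof (cases "X = {}")
    case True thus ?thesis using that[of 1] by simp
  next
    case False
    then obtain x where "x \<in> X" "\<And>y. y \<in> X \<Longrightarrow> F x \<le> F y"
      using continuous_attains_inf[OF cX _ contF] by blast
    thus ?thesis using that[of "F x"] pos by simp
  qed
  \<comment> \<open>The defect is three double sums of \<open>?N\<^sup>2\<close> terms of size at
    most \<open>k\<close>, hence stays below \<open>m\<close>; the cap 1 keeps the points within
    \<open>B\<close>.\<close>
  define k where "k = min 1 (m / (4 * ?N\<^sup>2))"
  have k: "k > 0" "k \<le> 1" "4 * ?N\<^sup>2 * k \<le> m"
    using m(1) by (auto simp: k_def min_def field_simps)
  show ?thesis
  proof (rule that[OF k(1)])
    fix p q :: "'i \<Rightarrow> 'a" and i
    assume p: "\<And>i j. i \<noteq> j \<Longrightarrow> \<bar>(norm (p i - p j))\<^sup>2 - 4\<bar> \<le> k"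
      and q: "\<And>i j. i \<noteq> j \<Longrightarrow> \<bar>(norm (q i - q j))\<^sup>2 - 4\<bar> \<le> k"
      and pq: "\<And>i j. (norm (q i - p j))\<^sup>2 \<le> 4 + k"
    show "\<exists>j. norm (q i - p j) < \<eta>"
    proof (rule ccontr)
      assume nf: "\<not> (\<exists>j. norm (q i - p j) < \<eta>)"
      have far: "\<eta> \<le> norm (q i - p j)" for j using nf by (auto simp: not_less)
      define P where "P = (\<chi> j. p j - q i)"
      define Q where "Q = (\<chi> j. q j - q i)"
      have n3: "norm x \<le> 3" if "(norm x)\<^sup>2 \<le> 5" for x :: 'a
        using that by (auto intro: power2_le_imp_le[of "norm x" 3])
      have "(norm (p j - q i))\<^sup>2 \<le> 5" for j using pq[of i j] k by (simp add: norm_minus_commute)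
      moreover have "(norm (q j - q i))\<^sup>2 \<le> 5" for j using q[of j i] k by (cases "j = i") auto
      ultimately have "(P, Q) \<in> X"
        using far n3 by (auto simp: X_def Y_def B_def P_def Q_def norm_minus_commute[of "q i"] intro!: exI[of _ i])
      hence "m \<le> F (P, Q)" by (rule m)
      also have "F (P, Q) = (\<Sum>i\<in>UNIV. \<Sum>j\<in>UNIV. if i = j then 0 else \<bar>(norm (p i - p j))\<^sup>2 - 4\<bar>)
         + (\<Sum>i\<in>UNIV. \<Sum>j\<in>UNIV. if i = j then 0 else \<bar>(norm (q i - q j))\<^sup>2 - 4\<bar>)
         + (\<Sum>i\<in>UNIV. \<Sum>j\<in>UNIV. max 0 ((norm (q i - p j))\<^sup>2 - 4))"
        by (simp add: F_def E_def P_def Q_def cong: if_cong)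
      also have "\<dots> \<le> (\<Sum>i\<in>(UNIV::'i set). \<Sum>j\<in>(UNIV::'i set). k) + (\<Sum>i\<in>(UNIV::'i set). \<Sum>j\<in>(UNIV::'i set). k)
         + (\<Sum>i\<in>(UNIV::'i set). \<Sum>j\<in>(UNIV::'i set). k)"
        using p q pq k(1) by (intro add_mono sum_mono) (auto simp: algebra_simps)
      also have "\<dots> = 3 * ?N\<^sup>2 * k" by (simp add: power2_eq_square)
      also have "\<dots> < 4 * ?N\<^sup>2 * k" using k(1) by simp
      finally show False using k(3) by simp
    qed
  qed
qed

text \<open>The cross distances bound the displacement along the edges of \<open>q\<close> from one
  side and along those of \<open>q'\<close> from the other. Exchanging the edges costs only a term
  quadratic in \<open>\<eta>\<close>, and \<open>frame_bound\<close> concludes.\<close>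

lemma near_regular_simplices_contract:
  fixes q q' :: "'i::finite \<Rightarrow> 'a::euclidean_space"
  assumes card: "CARD('i) = DIM('a) + 1" and k: "k * real CARD('i) \<le> 2"
    and q: "\<And>i j. i \<noteq> j \<Longrightarrow> \<bar>(norm (q i - q j))\<^sup>2 - 4\<bar> \<le> k"
    and q': "\<And>i j. i \<noteq> j \<Longrightarrow> \<bar>(norm (q' i - q' j))\<^sup>2 - 4\<bar> \<le> k"
    and qq': "\<And>i j. i \<noteq> j \<Longrightarrow> (norm (q i - q' j))\<^sup>2 \<le> 4 + k"
    and near: "\<And>i. norm (q i - q' i) \<le> 2 * \<eta>"
  shows "norm (q i - q' i) \<le> real CARD('i) * (k + 8 * \<eta>\<^sup>2)"
proof -
  define w where "w = (\<lambda>i. q' i - q i)"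
  have wn: "norm (w i) \<le> 2 * \<eta>" for i using near[of i] by (simp add: w_def norm_minus_commute)
  have \<eta>: "\<eta> \<ge> 0" using near[of i] norm_ge_zero[of "q i - q' i"] by linarith
  have bd: "\<bar>w i \<bullet> (q i - q j)\<bar> \<le> k + 8 * \<eta>\<^sup>2" if ij: "i \<noteq> j" for j
  proof -
    have "q' i - q j = w i + (q i - q j)" "q i - q' j = (q' i - q' j) - w i" by (auto simp: w_def)
    hence 1: "(norm (q' i - q j))\<^sup>2 = (norm (w i))\<^sup>2 + 2 * (w i \<bullet> (q i - q j)) + (norm (q i - q j))\<^sup>2"
      and 2: "(norm (q i - q' j))\<^sup>2 = (norm (q' i - q' j))\<^sup>2 - 2 * (w i \<bullet> (q' i - q' j)) + (norm (w i))\<^sup>2"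
      using norm_add_sq[of "w i" "q i - q j"] norm_diff_sq[of "q' i - q' j" "w i"]
      by (simp_all only: inner_commute[of "w i"])
    have 3: "w i \<bullet> (q i - q j) \<le> k"
    proof -
      have "(norm (q' i - q j))\<^sup>2 \<le> 4 + k" using qq'[of j i] ij by (simp add: norm_minus_commute)
      moreover have "(norm (q i - q j))\<^sup>2 \<ge> 4 - k" using q[OF ij] by linarith
      ultimately show ?thesis using 1 zero_le_power2[of "norm (w i)"] by linarith
    qed
    have 4: "- (w i \<bullet> (q' i - q' j)) \<le> k"
    proof -
      have "(norm (q' i - q' j))\<^sup>2 \<ge> 4 - k" using q'[OF ij] by linarith
      thus ?thesis using 2 qq'[OF ij] zero_le_power2[of "norm (w i)"] by linarith
    qed
    have "w i \<bullet> (q' i - q' j) = w i \<bullet> (q i - q j) + w i \<bullet> (w i - w j)"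
      by (simp add: w_def inner_diff_right)
    moreover have "w i \<bullet> (w i - w j) \<le> 8 * \<eta>\<^sup>2"
    proof -
      have "w i \<bullet> (w i - w j) \<le> norm (w i) * norm (w i - w j)" by (rule norm_cauchy_schwarz)
      also have "norm (w i - w j) \<le> 4 * \<eta>" using norm_triangle_ineq4[of "w i" "w j"] wn[of i] wn[of j] by linarith
      hence "norm (w i) * norm (w i - w j) \<le> (2 * \<eta>) * (4 * \<eta>)" using wn \<eta> by (intro mult_mono) auto
      finally show ?thesis by (simp add: power2_eq_square)
    qed
    ultimately show ?thesis using 3 4 zero_le_power2[of \<eta>] by linarith
  qed
  have "norm (w i) \<le> real CARD('i) * (k + 8 * \<eta>\<^sup>2)"
  proof (rule frame_bound[where p = q and i = i and w = "w i", OF card k q])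
    fix j
    have "CARD('i) \<ge> 2" using card by (simp add: Suc_leI DIM_positive)
    then obtain j' where "i \<noteq> j'" by (metis UNIV_I card_2_iff' ex_card)
    hence "k + 8 * \<eta>\<^sup>2 \<ge> 0" using q[of i j'] by (smt (verit) zero_le_power2)
    thus "\<bar>w i \<bullet> (q i - q j)\<bar> \<le> k + 8 * \<eta>\<^sup>2" using bd[of j] by (cases "i = j") auto
  qed
  thus ?thesis by (simp add: w_def norm_minus_commute)
qed

section \<open>Slabs and finite nets of directions\<close>

text \<open>The source of the quadratic gain: \<open>a - b\<close> is parallel to the query, so
  orthogonally to it \<open>x - y\<close> agrees with \<open>(x - a) - (y - b)\<close>, of length at
  most \<open>2 * \<eta>\<close>. Pythagoras adds the slab bound along the query.\<close>

lemma slab_dist_bound: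
  fixes a b x y :: "'a::real_inner"
  assumes "a \<noteq> b" "\<bar>(x - y) \<bullet> sgn (a - b)\<bar> \<le> 2" "norm (x - a) \<le> \<eta>" "norm (y - b) \<le> \<eta>"
  shows "(norm (x - y))\<^sup>2 \<le> 4 + 4 * \<eta>\<^sup>2"
proof -
  define v where "v = sgn (a - b)"
  define t where "t = (x - a) - (y - b)"
  define u where "u = x - y"
  have v: "v \<bullet> v = 1" using assms(1) by (simp add: v_def norm_sgn flip: power2_norm_eq_inner)
  have "a - b = norm (a - b) *\<^sub>R v" using assms(1) by (simp add: v_def sgn_div_norm)
  then obtain c where "a - b = c *\<^sub>R v" by blast
  hence t: "t = u - c *\<^sub>R v" by (simp add: t_def u_def algebra_simps)
  have "t \<bullet> t - (t \<bullet> v)\<^sup>2 = u \<bullet> u - (u \<bullet> v)\<^sup>2"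
    using v by (simp add: t inner_diff inner_commute power2_eq_square algebra_simps)
  hence "(norm u)\<^sup>2 \<le> (u \<bullet> v)\<^sup>2 + (norm t)\<^sup>2"
    using zero_le_power2[of "t \<bullet> v"] by (simp only: power2_norm_eq_inner)
  moreover have "(u \<bullet> v)\<^sup>2 \<le> 2\<^sup>2" using assms(2) unfolding u_def v_def abs_le_square_iff[symmetric] by simp
  moreover have "norm t \<le> 2 * \<eta>" unfolding t_def using norm_triangle_ineq4[of "x - a" "y - b"] assms by linarith
  hence "(norm t)\<^sup>2 \<le> (2 * \<eta>)\<^sup>2" by (intro power_mono) auto
  ultimately show ?thesis by (simp add: u_def power_mult_distrib)
qed

text \<open>A unit vector \<open>v\<close> within \<open>r\<close> of the direction of
  \<open>w\<close> satisfies \<open>w \<bullet> v \<ge> (1 - r / 2) * norm w\<close>, so a finite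
  net of the sphere controls all lengths.\<close>

lemma direction_net:
  assumes "k > 0"
  obtains V :: "'a::euclidean_space set" where "finite V" "\<And>v. v \<in> V \<Longrightarrow> norm v = 1"
    "\<And>w. (\<And>v. v \<in> V \<Longrightarrow> \<bar>w \<bullet> v\<bar> \<le> 2) \<Longrightarrow> (norm w)\<^sup>2 \<le> 4 + k"
proof -
  \<comment> \<open>Chosen so that
    \<open>(2 * (1 + r))\<^sup>2 \<le> 4 + 12 * r \<le> 4 + k\<close>.\<close>
  define r where "r = min 1 (k / 12)"
  have r: "0 < r" "r \<le> 1" "12 * r \<le> k" using assms by (auto simp: r_def)
  have "compact (sphere 0 1 :: 'a set)" by simp
  then obtain V :: "'a set" where V: "finite V" "V \<subseteq> sphere 0 1" "sphere 0 1 \<subseteq> (\<Union>v\<in>V. ball v r)"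
    using seq_compact_imp_totally_bounded[of "sphere 0 1 :: 'a set"] r(1)
    unfolding compact_eq_seq_compact_metric by metis
  show ?thesis
  proof (rule that[OF V(1)])
    show "norm v = 1" if "v \<in> V" for v using V that by auto
    fix w :: 'a assume w: "\<And>v. v \<in> V \<Longrightarrow> \<bar>w \<bullet> v\<bar> \<le> 2"
    show "(norm w)\<^sup>2 \<le> 4 + k"
    proof (cases "w = 0")
      case False
      define u where "u = sgn w"
      have u: "norm u = 1" using False by (simp add: u_def norm_sgn)
      have wu: "w = norm w *\<^sub>R u" using False by (simp add: u_def sgn_div_norm)
      obtain v where v: "v \<in> V" "dist v u < r" using V(3) u by (auto simp: subset_iff)
      have nv: "norm v = 1" using V v by auto
      have "(norm (v - u))\<^sup>2 \<le> r\<^sup>2" using v by (intro power_mono) (auto simp: dist_norm)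
      also have "r\<^sup>2 \<le> r" using r by (simp add: power2_eq_square mult_left_le)
      finally have "1 - r / 2 \<le> u \<bullet> v" using u nv by (simp add: norm_diff_sq inner_commute)
      hence "norm w * (1 - r / 2) \<le> norm w * (u \<bullet> v)" by (intro mult_left_mono) auto
      also have "\<dots> = w \<bullet> v" by (metis wu inner_scaleR_left)
      also have "\<dots> \<le> 2" using w[OF v(1)] by simp
      finally have "norm w * (1 - r / 2) \<le> 2" .
      \<comment> \<open>Multiplication by \<open>1 + r\<close> replaces division by
        \<open>1 - r / 2\<close>, as their product is at least 1 for \<open>r\<close> between 0 and
        1.\<close>
      moreover have "norm w * 1 \<le> norm w * ((1 - r / 2) * (1 + r))"
        using r by (intro mult_left_mono) (auto simp: algebra_simps power2_eq_square intro: mult_left_le)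
      ultimately have "norm w \<le> 2 * (1 + r)"
        using mult_right_mono[of "norm w * (1 - r / 2)" 2 "1 + r"] r by (simp add: mult.assoc)
      hence "(norm w)\<^sup>2 \<le> (2 * (1 + r))\<^sup>2" by (intro power_mono) auto
      also have "\<dots> = 4 + 8 * r + 4 * (r * r)" by (simp add: power2_eq_square algebra_simps)
      also have "\<dots> \<le> 4 + 12 * r" using r mult_left_le[of r r] by simp
      finally show ?thesis using r by simp
    qed (use assms in simp)
  qed
qed

section \<open>Clusters of witnesses\<close>

text \<open>Circumradius of the regular simplex with \<open>n\<close> vertices and edge 2; dimension
  d corresponds to \<open>n = d + 1\<close>.\<close>

definition jung_radius :: "nat \<Rightarrow> real" where
  "jung_radius n = sqrt (2 * (1 - 1 / real n))"

text \<open>A tuple certifying that \<open>S\<close> fits in no ball of the Jung radius; for d + 1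
  indices, Helly provides one whenever \<open>S\<close> does not fit.\<close>

definition witness :: "'a::real_inner set \<Rightarrow> ('i::finite \<Rightarrow> 'a) \<Rightarrow> bool" where
  "witness S q \<longleftrightarrow> range q \<subseteq> S \<and> (\<forall>z. \<exists>i. norm (q i - z) > jung_radius CARD('i))"

text \<open>The numbering of a witness is arbitrary, hence the permutation. \<open>inj p\<close>
  stands under the implication so that a set without witnesses is clustered around any
  \<open>p\<close>.\<close>

definition clustered :: "('i::finite \<Rightarrow> 'a::real_inner) \<Rightarrow> 'a set \<Rightarrow> real \<Rightarrow> bool" where
  "clustered p S \<eta> \<longleftrightarrow>
     (\<forall>q :: 'i \<Rightarrow> 'a. witness S q \<longrightarrow> inj p \<and> (\<exists>s. bij s \<and> (\<forall>i. norm (q (s i) - p i) \<le> \<eta>)))"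

lemma jung_radius_sq: "(jung_radius n)\<^sup>2 = 2 * (1 - 1 / real n)"
  by (cases n) (auto simp: jung_radius_def field_simps)

lemma jung_radius_nonneg: "jung_radius n \<ge> 0"
  by (cases n) (auto simp: jung_radius_def field_simps)

lemma jung_radius_le_2: "jung_radius n \<le> 2"
proof (rule power2_le_imp_le)
  have *: "2 * (1 - y) \<le> 2\<^sup>2" if "0 \<le> y" for y :: real using that by simp
  show "(jung_radius n)\<^sup>2 \<le> 2\<^sup>2" unfolding jung_radius_sq by (rule *) simp
qed simp

lemma witness_mem: "witness S q \<Longrightarrow> q i \<in> S"
  by (auto simp: witness_def)

lemma card_UNIV_ge_1: "CARD('i::finite) \<ge> 1"
  by (simp add: Suc_leI)

lemma witness_comp_bij:
  fixes q :: "'i::finite \<Rightarrow> 'a::real_inner" and s :: "'i \<Rightarrow> 'i"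
  assumes "witness S q" "bij s"
  shows "witness S (q \<circ> s)"
proof -
  have "\<exists>i. norm ((q \<circ> s) i - z) > jung_radius CARD('i)" for z
  proof -
    obtain i where "norm (q i - z) > jung_radius CARD('i)" using assms(1) by (auto simp: witness_def)
    thus ?thesis using assms(2) by (metis bij_pointE comp_apply)
  qed
  thus ?thesis using assms(1) by (auto simp: witness_def)
qed

lemma witness_mono: "witness S q \<Longrightarrow> S \<subseteq> S' \<Longrightarrow> witness S' q"
  by (auto simp: witness_def)

text \<open>Upper bounds on the edges of a witness imply lower bounds: by \<open>jung_dual\<close>
  some weights give it more than the Jung variance, so \<open>edges_ge\<close> applies.\<close>

lemma witness_near_regular:
  fixes q :: "'i::finite \<Rightarrow> 'a::real_inner"
  assumes q: "witness S q" and e: "0 \<le> e" "e * (real CARD('i))\<^sup>2 \<le> 1"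
    and le: "\<And>i j. i \<noteq> j \<Longrightarrow> (norm (q i - q j))\<^sup>2 \<le> 4 + e" and ij: "i \<noteq> j"
  shows "\<bar>(norm (q i - q j))\<^sup>2 - 4\<bar> \<le> 4 * (real CARD('i))\<^sup>2 * e"
proof -
  let ?N = "real CARD('i)"
  have N: "?N \<ge> 1" using card_UNIV_ge_1[where 'i = 'i] by linarith
  obtain l where l: "\<And>i. 0 \<le> l i" "sum l UNIV = 1" "gvar l q > (jung_radius CARD('i))\<^sup>2"
    using jung_dual[where p = q and \<rho> = "jung_radius CARD('i)"] q jung_radius_nonneg
    unfolding witness_def by metis
  hence "gvar l q \<ge> 2 * (1 - 1 / ?N)" using jung_radius_sq[of "CARD('i)"] by simp
  from edges_ge[where l = l and p = q, OF l(1,2) this e le ij]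
  have "(norm (q i - q j))\<^sup>2 \<ge> 4 - 4 * ?N\<^sup>2 * e" .
  moreover have "1 * e \<le> (4 * ?N\<^sup>2) * e"
    using N e one_le_power[OF N, of 2] by (intro mult_right_mono) linarith+
  ultimately show ?thesis using le[OF ij] by linarith
qed

text \<open>Jung's theorem with edge bounds for witnesses only: a tuple fitting in no ball of the
  enlarged radius is itself a witness, and its dual weights would violate
  \<open>gvar_le\<close>.\<close>

lemma radius_bound:
  fixes S :: "'a::euclidean_space set"
  assumes card: "CARD('i::finite) = DIM('a) + 1" and e: "e \<ge> 0"
    and le: "\<And>(q :: 'i \<Rightarrow> 'a) i j. witness S q \<Longrightarrow> i \<noteq> j \<Longrightarrow> (norm (q i - q j))\<^sup>2 \<le> 4 + e"
  shows "\<exists>z. \<forall>x\<in>S. norm (x - z) \<le> jung_radius CARD('i) * sqrt (1 + e / 4)"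
proof (rule helly_balls[OF card], rule ccontr)
  let ?J = "jung_radius CARD('i)"
  let ?\<rho> = "?J * sqrt (1 + e / 4)"
  fix q :: "'i \<Rightarrow> 'a"
  assume q: "range q \<subseteq> S" and "\<not> (\<exists>z. \<forall>i. norm (q i - z) \<le> ?\<rho>)"
  hence no: "\<exists>i. norm (q i - z) > ?\<rho>" for z by (auto simp: not_le)
  have J: "?J \<ge> 0" by (rule jung_radius_nonneg)
  have "?J * 1 \<le> ?\<rho>" using J e by (intro mult_left_mono) auto
  hence "\<exists>i. norm (q i - z) > ?J" for z using no[of z] by (metis mult.right_neutral order_le_less_trans)
  hence w: "witness S q" using q by (simp add: witness_def)
  have "?\<rho> \<ge> 0" using J e by simp
  then obtain l where l: "\<And>i. 0 \<le> l i" "sum l UNIV = 1" "gvar l q > ?\<rho>\<^sup>2"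
    using jung_dual[where p = q and \<rho> = ?\<rho>] no by metis
  have "gvar l q \<le> (4 + e) / 2 * (1 - 1 / real CARD('i))"
    using gvar_le[of l "4 + e" q] l e le[OF w] by simp
  moreover have "?\<rho>\<^sup>2 = (4 + e) / 2 * (1 - 1 / real CARD('i))"
    using e by (simp add: power_mult_distrib jung_radius_sq field_simps)
  ultimately show False using l(3) by simp
qed

text \<open>The effect of querying all edge directions of \<open>p\<close>.
  \<open>slab_dist_bound\<close> controls distances between differently indexed points, within one
  witness and across two; \<open>radius_bound\<close> then gives the ball and
  \<open>near_regular_simplices_contract\<close> the new cluster.\<close>

lemma clustered_step:
  fixes p :: "'i::finite \<Rightarrow> 'a::euclidean_space" and S :: "'a set"
  defines "N \<equiv> real CARD('i)"
  assumes card: "CARD('i) = DIM('a) + 1" and \<eta>: "0 \<le> \<eta>" "\<eta> * (4 * N\<^sup>2) \<le> 1"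
    and cl: "clustered p S \<eta>" and S': "S' \<subseteq> S"
    and slab: "\<And>x y i j. \<lbrakk>x \<in> S'; y \<in> S'; p i \<noteq> p j\<rbrakk> \<Longrightarrow> \<bar>(x - y) \<bullet> sgn (p i - p j)\<bar> \<le> 2"
  shows "\<exists>p' :: 'i \<Rightarrow> 'a. clustered p' S' (24 * N ^ 3 * \<eta>\<^sup>2)"
    and "\<exists>z. \<forall>x\<in>S'. norm (x - z) \<le> jung_radius CARD('i) * sqrt (1 + \<eta>\<^sup>2)"
proof -
  \<comment> \<open>The two-sided edge error that \<open>witness_near_regular\<close> derives from
    the excess \<open>e = 4 * \<eta>\<^sup>2\<close>.\<close>
  define k where "k = 4 * N\<^sup>2 * (4 * \<eta>\<^sup>2)"
  have N: "N \<ge> 1" using card_UNIV_ge_1[where 'i = 'i] unfolding N_def by linarith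
  have sq: "16 * (\<eta>\<^sup>2 * N ^ 4) \<le> 1"
  proof -
    have "(\<eta> * (4 * N\<^sup>2))\<^sup>2 \<le> 1\<^sup>2" using \<eta> N by (intro power_mono) auto
    thus ?thesis by (simp add: power_mult_distrib mult_ac flip: power_mult)
  qed
  have N34: "N ^ 3 \<le> N ^ 4" "N\<^sup>2 \<le> N ^ 4" using N by (auto intro: power_increasing)
  have e: "0 \<le> 4 * \<eta>\<^sup>2" "4 * \<eta>\<^sup>2 * N\<^sup>2 \<le> 1"
    using sq mult_left_mono[OF N34(2), of "\<eta>\<^sup>2"] zero_le_power2[of \<eta>] by linarith+
  have k: "k * N \<le> 2"
    using sq mult_left_mono[OF N34(1), of "\<eta>\<^sup>2"]
    by (simp add: k_def power2_eq_square power3_eq_cube mult_ac)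
  have k0: "4 * \<eta>\<^sup>2 \<le> k"
  proof -
    have "1 * \<eta>\<^sup>2 \<le> (4 * N\<^sup>2) * \<eta>\<^sup>2"
      using one_le_power[OF N, of 2] by (intro mult_right_mono) auto
    thus ?thesis by (simp add: k_def)
  qed
  have inj: "inj p" if "witness S' q" for q :: "'i \<Rightarrow> 'a"
    using cl witness_mono[OF that S'] by (auto simp: clustered_def)
  have perm: "\<exists>s. bij s \<and> (\<forall>i. norm (q (s i) - p i) \<le> \<eta>)" if "witness S' q" for q :: "'i \<Rightarrow> 'a"
    using cl witness_mono[OF that S'] by (auto simp: clustered_def)
  have dist: "(norm (q i - q' j))\<^sup>2 \<le> 4 + 4 * \<eta>\<^sup>2"
    if "witness S' q" "witness S' q'" "\<And>i. norm (q i - p i) \<le> \<eta>" "\<And>i. norm (q' i - p i) \<le> \<eta>" "i \<noteq> j"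
    for q q' :: "'i \<Rightarrow> 'a" and i j
  proof (rule slab_dist_bound)
    show "p i \<noteq> p j" using inj[OF that(1)] that(5) by (auto dest: injD)
    thus "\<bar>(q i - q' j) \<bullet> sgn (p i - p j)\<bar> \<le> 2" using slab[OF witness_mem[OF that(1)] witness_mem[OF that(2)]] by blast
  qed (use that in auto)
  have reg: "\<bar>(norm (q i - q j))\<^sup>2 - 4\<bar> \<le> k"
    if "witness S' q" "\<And>i. norm (q i - p i) \<le> \<eta>" "i \<noteq> j" for q :: "'i \<Rightarrow> 'a" and i j
    unfolding k_def N_def
    using e by (intro witness_near_regular[OF that(1)] dist that) (auto simp: N_def)
  show "\<exists>z. \<forall>x\<in>S'. norm (x - z) \<le> jung_radius CARD('i) * sqrt (1 + \<eta>\<^sup>2)"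
  proof -
    have "(norm (q i - q j))\<^sup>2 \<le> 4 + 4 * \<eta>\<^sup>2" if q: "witness S' q" and ij: "i \<noteq> j" for q :: "'i \<Rightarrow> 'a" and i j
    proof -
      obtain s where s: "bij s" "\<And>i. norm (q (s i) - p i) \<le> \<eta>" using perm[OF q] by auto
      obtain a b where ab: "i = s a" "j = s b" using s(1) by (metis bij_pointE)
      have "(norm ((q \<circ> s) a - (q \<circ> s) b))\<^sup>2 \<le> 4 + 4 * \<eta>\<^sup>2"
        using s ij ab by (intro dist witness_comp_bij q) auto
      thus ?thesis by (simp add: ab)
    qed
    from radius_bound[OF card e(1) this] show ?thesis by simp
  qed
  show "\<exists>p' :: 'i \<Rightarrow> 'a. clustered p' S' (24 * N ^ 3 * \<eta>\<^sup>2)"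
  proof (cases "\<exists>q :: 'i \<Rightarrow> 'a. witness S' q")
    case False
    thus ?thesis by (auto simp: clustered_def)
  next
    case True
    then obtain p0 :: "'i \<Rightarrow> 'a" where p0: "witness S' p0" by blast
    then obtain s0 where s0: "bij s0" "\<And>i. norm (p0 (s0 i) - p i) \<le> \<eta>" using perm by blast
    define p' where "p' = p0 \<circ> s0"
    have p': "witness S' p'" "\<And>i. norm (p' i - p i) \<le> \<eta>"
      using s0 p0 by (auto simp: p'_def intro: witness_comp_bij)
    have "inj p'"
    proof (rule injI, rule ccontr)
      fix i j assume "p' i = p' j" "i \<noteq> j"
      \<comment> \<open>Now \<open>k * N \<le> 2\<close> yields \<open>k \<le> 1\<close>, whereas
        coinciding vertices would force \<open>4 \<le> k\<close>.\<close>
      moreover have "N \<ge> 2" using card unfolding N_def by (simp add: Suc_leI DIM_positive)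
      hence "k * 2 \<le> k * N" using k0 zero_le_power2[of \<eta>] by (intro mult_left_mono) linarith+
      ultimately show False using reg[OF p', of i j] k by auto
    qed
    moreover have "\<exists>s. bij s \<and> (\<forall>i. norm (q (s i) - p' i) \<le> 24 * N ^ 3 * \<eta>\<^sup>2)" if q: "witness S' q" for q :: "'i \<Rightarrow> 'a"
    proof -
      obtain s where s: "bij s" "\<And>i. norm (q (s i) - p i) \<le> \<eta>" using perm[OF q] by auto
      have w: "witness S' (q \<circ> s)" "\<And>i. norm ((q \<circ> s) i - p i) \<le> \<eta>"
        using q s by (auto intro: witness_comp_bij)
      have "norm ((q \<circ> s) i - p' i) \<le> 24 * N ^ 3 * \<eta>\<^sup>2" for i
      proof -
        have "norm ((q \<circ> s) i - p' i) \<le> real CARD('i) * (k + 8 * \<eta>\<^sup>2)"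
        proof (rule near_regular_simplices_contract[OF card])
          show "k * real CARD('i) \<le> 2" using k by (simp add: N_def)
          show "norm ((q \<circ> s) i - p' i) \<le> 2 * \<eta>" for i
            using norm_triangle_ineq4[of "(q \<circ> s) i - p i" "p' i - p i"] w(2)[of i] p'(2)[of i] by simp
          show "(norm ((q \<circ> s) i - p' j))\<^sup>2 \<le> 4 + k" if "i \<noteq> j" for i j
            using dist[OF w(1) p'(1) w(2) p'(2) that] k0 by linarith
        qed (use reg[OF w] reg[OF p'] in blast)+
        also have "\<dots> \<le> 24 * N ^ 3 * \<eta>\<^sup>2"
        proof -
          have "N * \<eta>\<^sup>2 \<le> N ^ 3 * \<eta>\<^sup>2"
            using N power_increasing[of 1 3 N] by (intro mult_right_mono) auto
          thus ?thesis by (simp add: k_def N_def power2_eq_square power3_eq_cube algebra_simps)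
        qed
        finally show ?thesis .
      qed
      thus ?thesis using s(1) by auto
    qed
    ultimately show ?thesis by (auto simp: clustered_def)
  qed
qed

text \<open>A net brings all distances in \<open>S\<close> close to 2 or below, so every witness is
  almost regular, and \<open>near_regular_simplices_match\<close> pairs any witness with a fixed
  one.\<close>

lemma clustered_initial:
  fixes \<eta> :: real
  assumes card: "CARD('i::finite) = DIM('a::euclidean_space) + 1" and \<eta>: "\<eta> > 0"
  obtains V :: "'a::euclidean_space set" where "finite V" "\<And>v. v \<in> V \<Longrightarrow> norm v = 1"
    "\<And>S. (\<And>x y v. \<lbrakk>x \<in> S; y \<in> S; v \<in> V\<rbrakk> \<Longrightarrow> \<bar>(x - y) \<bullet> v\<bar> \<le> 2) \<Longrightarrow> \<exists>p :: 'i \<Rightarrow> 'a. clustered p S \<eta>"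
proof -
  let ?N = "real CARD('i)"
  have N: "?N \<ge> 1" using card_UNIV_ge_1[where 'i = 'i] by linarith
  \<comment> \<open>With \<open>h \<le> 1 / 2\<close>, two vertices matched with the same point
    would be at distance at most 1, against squared edges of at least 3.\<close>
  define h where "h = min \<eta> (1 / 2)"
  have h: "h > 0" "h \<le> \<eta>" "h \<le> 1 / 2" using \<eta> by (auto simp: h_def)
  obtain k where k: "k > 0"
    "\<And>(p :: 'i \<Rightarrow> 'a) (q :: 'i \<Rightarrow> 'a) i. \<lbrakk>\<And>i j. i \<noteq> j \<Longrightarrow> \<bar>(norm (p i - p j))\<^sup>2 - 4\<bar> \<le> k;
       \<And>i j. i \<noteq> j \<Longrightarrow> \<bar>(norm (q i - q j))\<^sup>2 - 4\<bar> \<le> k;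
       \<And>i j. (norm (q i - p j))\<^sup>2 \<le> 4 + k\<rbrakk> \<Longrightarrow> \<exists>j. norm (q i - p j) < h"
    using near_regular_simplices_match[OF card h(1)] by metis
  define e where "e = min k 1 / (4 * ?N\<^sup>2)"
  have e: "e > 0" "4 * ?N\<^sup>2 * e = min k 1" using k(1) N by (auto simp: e_def)
  have "1 * e \<le> (4 * ?N\<^sup>2) * e" using e(1) one_le_power[OF N, of 2] by (intro mult_right_mono) linarith+
  hence ek: "e \<le> k" "e * ?N\<^sup>2 \<le> 1" "4 * ?N\<^sup>2 * e \<le> k" "4 * ?N\<^sup>2 * e \<le> 1" using e(2) by (auto simp: mult_ac)
  obtain V :: "'a set" where V: "finite V" "\<And>v. v \<in> V \<Longrightarrow> norm v = 1"
    "\<And>w. (\<And>v. v \<in> V \<Longrightarrow> \<bar>w \<bullet> v\<bar> \<le> 2) \<Longrightarrow> (norm w)\<^sup>2 \<le> 4 + e"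
    using direction_net[OF e(1)] by metis
  show ?thesis
  proof (rule that[OF V(1,2)])
    fix S assume S: "\<And>x y v. \<lbrakk>x \<in> S; y \<in> S; v \<in> V\<rbrakk> \<Longrightarrow> \<bar>(x - y) \<bullet> v\<bar> \<le> 2"
    have S2: "(norm (x - y))\<^sup>2 \<le> 4 + e" if "x \<in> S" "y \<in> S" for x y using V(3) S that by blast
    have reg: "\<bar>(norm (q i - q j))\<^sup>2 - 4\<bar> \<le> 4 * ?N\<^sup>2 * e" if "witness S q" "i \<noteq> j" for q :: "'i \<Rightarrow> 'a" and i j
      using e(1) ek(2) S2[OF witness_mem[OF that(1)] witness_mem[OF that(1)]] that(2)
      by (intro witness_near_regular[OF that(1)]) auto
    show "\<exists>p :: 'i \<Rightarrow> 'a. clustered p S \<eta>"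
    proof (cases "\<exists>p :: 'i \<Rightarrow> 'a. witness S p")
      case False
      thus ?thesis by (auto simp: clustered_def)
    next
      case True
      then obtain p :: "'i \<Rightarrow> 'a" where p: "witness S p" by blast
      have far: "(norm (p i - p j))\<^sup>2 \<ge> 3" if "i \<noteq> j" for i j
        using reg[OF p that] ek(4) by linarith
      have "inj p"
      proof (rule injI, rule ccontr)
        fix i j assume "p i = p j" "i \<noteq> j" thus False using far[of i j] by simp
      qed
      moreover have "\<exists>s. bij s \<and> (\<forall>i. norm (q (s i) - p i) \<le> \<eta>)" if q: "witness S q" for q :: "'i \<Rightarrow> 'a"
      proof -
        have "\<exists>j. norm (p i - q j) < h" for i
        proof (rule k(2))
          show "(norm (p i - q j))\<^sup>2 \<le> 4 + k" for i j
            using S2[OF witness_mem[OF p] witness_mem[OF q], of i j] ek(1) by linarith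
        qed (use reg[OF p] reg[OF q] ek(3) order_trans in blast)+
        then obtain s where s: "\<And>i. norm (p i - q (s i)) < h" by metis
        have "inj s"
        proof (rule injI, rule ccontr)
          fix i j assume ij: "s i = s j" "i \<noteq> j"
          have "norm (p i - p j) \<le> norm (p i - q (s i)) + norm (p j - q (s j))"
            using norm_triangle_ineq4[of "p i - q (s i)" "p j - q (s j)"] ij by simp
          hence "norm (p i - p j) \<le> 1" using s[of i] s[of j] h by linarith
          hence "(norm (p i - p j))\<^sup>2 \<le> 1\<^sup>2" by (intro power_mono) auto
          thus False using far[OF ij(2)] by simp
        qed
        hence "bij s" by (simp add: bij_def finite_UNIV_inj_surj)
        moreover have "norm (q (s i) - p i) \<le> \<eta>" for i
          using s[of i] h by (simp add: norm_minus_commute)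
        ultimately show ?thesis by blast
      qed
      ultimately show ?thesis by (auto simp: clustered_def)
    qed
  qed
qed

section \<open>Strategy of the reconstructor\<close>

text \<open>The game for \<delta> = 1 as a recursion on the set of secrets compatible with the
  answers so far: the reconstructor picks \<open>v\<close>, the adversary \<open>r\<close>, and a
  slab cuts the set.\<close>

primrec solvable :: "nat \<Rightarrow> real \<Rightarrow> 'a::real_inner set \<Rightarrow> bool" where
  "solvable 0 \<rho> S \<longleftrightarrow> (\<exists>z. \<forall>x\<in>S. norm (x - z) \<le> \<rho>)"
| "solvable (Suc T) \<rho> S \<longleftrightarrow> (\<exists>v. norm v = 1 \<and> (\<forall>r. solvable T \<rho> (S \<inter> {x. \<bar>r - x \<bullet> v\<bar> \<le> 1})))"

lemma solvable_subset: "solvable T \<rho> S \<Longrightarrow> S' \<subseteq> S \<Longrightarrow> solvable T \<rho> S'"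
proof (induction T arbitrary: S S')
  case (Suc T)
  then obtain v where v: "norm v = 1" "\<And>r. solvable T \<rho> (S \<inter> {x. \<bar>r - x \<bullet> v\<bar> \<le> 1})" by auto
  have "solvable T \<rho> (S' \<inter> {x. \<bar>r - x \<bullet> v\<bar> \<le> 1})" for r
    using Suc.prems(2) by (intro Suc.IH[OF v(2)[of r]]) auto
  thus ?case using v(1) by auto
qed auto

lemma solvable_mono_rounds:
  fixes S :: "'a::euclidean_space set"
  assumes "solvable T \<rho> S" "T \<le> T'"
  shows "solvable T' \<rho> S"
proof -
  obtain b :: 'a where b: "b \<in> Basis" using nonempty_Basis by blast
  have "solvable (Suc T) \<rho> S" if "solvable T \<rho> S" for T
    using norm_Basis[OF b] solvable_subset[OF that] by auto
  with assms(2,1) show ?thesis by (induction rule: dec_induct) auto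
qed

lemma solvable_mono_radius: "solvable T \<rho> S \<Longrightarrow> \<rho> \<le> \<rho>' \<Longrightarrow> solvable T \<rho>' S"
proof (induction T arbitrary: S)
  case 0
  thus ?case by (auto intro: order_trans)
qed auto

text \<open>A non-adaptive block of queries: whatever the answers, the remaining secrets have width
  at most 2 in every direction of \<open>V\<close>. The slack in \<open>m\<close> makes block
  lengths uniform.\<close>

lemma solvable_queries:
  fixes S :: "'a::euclidean_space set"
  assumes "finite V" "\<And>v. v \<in> V \<Longrightarrow> norm v = 1" "card V \<le> m"
    and "\<And>S'. \<lbrakk>S' \<subseteq> S; \<And>x y v. \<lbrakk>x \<in> S'; y \<in> S'; v \<in> V\<rbrakk> \<Longrightarrow> \<bar>(x - y) \<bullet> v\<bar> \<le> 2\<rbrakk> \<Longrightarrow> solvable T \<rho> S'"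
  shows "solvable (m + T) \<rho> S"
  using assms
proof (induction V arbitrary: S m rule: finite_induct)
  case empty
  have "solvable T \<rho> S" using empty.prems(3)[of S] by simp
  thus ?case by (rule solvable_mono_rounds) simp
next
  case (insert v V)
  obtain m' where m: "m = Suc m'" "card V \<le> m'"
    using insert.prems(2) insert.hyps by (cases m) auto
  have "solvable (m' + T) \<rho> (S \<inter> {x. \<bar>r - x \<bullet> v\<bar> \<le> 1})" for r
  proof (rule insert.IH)
    fix S' assume S': "S' \<subseteq> S \<inter> {x. \<bar>r - x \<bullet> v\<bar> \<le> 1}"
      and V: "\<And>x y v. \<lbrakk>x \<in> S'; y \<in> S'; v \<in> V\<rbrakk> \<Longrightarrow> \<bar>(x - y) \<bullet> v\<bar> \<le> 2"
    show "solvable T \<rho> S'"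
    proof (rule insert.prems(3))
      fix x y u assume xy: "x \<in> S'" "y \<in> S'" and "u \<in> insert v V"
      moreover have "\<bar>(x - y) \<bullet> v\<bar> \<le> 2"
      proof -
        have "\<bar>r - x \<bullet> v\<bar> \<le> 1" "\<bar>r - y \<bullet> v\<bar> \<le> 1" using S' xy by auto
        thus ?thesis unfolding inner_diff_left by linarith
      qed
      ultimately show "\<bar>(x - y) \<bullet> u\<bar> \<le> 2" using V[OF xy] by blast
    qed (use S' in blast)
  qed (use insert.prems m in auto)
  thus ?case using insert.prems(1)[of v] m(1) by auto
qed

section \<open>From the recursion on sets to strategies\<close>

lemma consistent_Cons:
  "consistent Q (Suc T) \<delta> x (a # r) \<longleftrightarrow>
     \<bar>a - x \<bullet> Q []\<bar> \<le> \<delta> \<and> consistent (\<lambda>h. Q (a # h)) T \<delta> x r"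
  unfolding consistent_def by (auto simp: less_Suc_eq_0_disj)

text \<open>The first query is \<open>v\<close>, and a continuation is chosen for every possible
  first answer, which later histories carry as their head.\<close>

lemma solvable_imp_strategy:
  fixes S :: "(real^'n::finite) set"
  assumes "solvable T \<rho> S"
  shows "\<exists>Q Out. unit_queries Q \<and> (\<forall>x\<in>S. \<forall>r. consistent Q T 1 x r \<longrightarrow> norm (Out r - x) \<le> \<rho>)"
  using assms
proof (induction T arbitrary: S)
  case 0
  then obtain z where "\<forall>x\<in>S. norm (x - z) \<le> \<rho>" by auto
  moreover obtain b :: "real^'n" where "b \<in> Basis" using nonempty_Basis by blast
  ultimately show ?case
    by (intro exI[of _ "\<lambda>_. b"] exI[of _ "\<lambda>_. z"]) (auto simp: unit_queries_def norm_minus_commute)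
next
  case (Suc T)
  then obtain v where v: "norm v = 1" "\<And>a. solvable T \<rho> (S \<inter> {x. \<bar>a - x \<bullet> v\<bar> \<le> 1})" by auto
  have "\<forall>a. \<exists>Q Out. unit_queries Q \<and>
      (\<forall>x\<in>S \<inter> {x. \<bar>a - x \<bullet> v\<bar> \<le> 1}. \<forall>r. consistent Q T 1 x r \<longrightarrow> norm (Out r - x) \<le> \<rho>)"
    using Suc.IH[OF v(2)] by blast
  then obtain Qs Outs where QO: "\<And>a. unit_queries (Qs a)"
    "\<And>a x r. \<lbrakk>x \<in> S; \<bar>a - x \<bullet> v\<bar> \<le> 1; consistent (Qs a) T 1 x r\<rbrakk> \<Longrightarrow> norm (Outs a r - x) \<le> \<rho>"
    by (metis (no_types, lifting) IntI mem_Collect_eq)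
  define Q where "Q = (\<lambda>h. case h of [] \<Rightarrow> v | a # h' \<Rightarrow> Qs a h')"
  define Out where "Out = (\<lambda>h. Outs (hd h) (tl h))"
  have "unit_queries Q" using v(1) QO(1) by (auto simp: unit_queries_def Q_def split: list.split)
  moreover have "norm (Out r - x) \<le> \<rho>" if x: "x \<in> S" "consistent Q (Suc T) 1 x r" for x r
  proof -
    obtain a r' where r: "r = a # r'" using x(2) by (cases r) (auto simp: consistent_def)
    have "\<bar>a - x \<bullet> v\<bar> \<le> 1" "consistent (Qs a) T 1 x r'"
      using x(2) unfolding r consistent_Cons by (auto simp: Q_def)
    thus ?thesis using QO(2)[OF x(1)] by (simp add: Out_def r)
  qed
  ultimately show ?case by blast
qed

text \<open>Iterates \<open>clustered_step\<close>. With \<open>C = 24 * N ^ 3\<close>, replacing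
  \<open>\<eta>\<close> by \<open>C * \<eta>\<^sup>2\<close> squares \<open>C * \<eta>\<close>, so
  \<open>k\<close> blocks lead to \<open>(C * \<eta>) ^ (2 ^ k) / C\<close>; one more block gives
  the ball.\<close>

lemma clustered_solvable:
  fixes p :: "'i::finite \<Rightarrow> 'a::euclidean_space" and S :: "'a set"
  defines "N \<equiv> real CARD('i)"
  assumes card: "CARD('i) = DIM('a) + 1"
    and "clustered p S \<eta>" "0 \<le> \<eta>" "24 * N ^ 3 * \<eta> \<le> 1"
  shows "solvable (Suc k * (CARD('i))\<^sup>2)
    (jung_radius CARD('i) * sqrt (1 + ((24 * N ^ 3 * \<eta>) ^ (2 ^ k) / (24 * N ^ 3))\<^sup>2)) S"
proof -
  define V where "V = (\<lambda>p :: 'i \<Rightarrow> 'a. (\<lambda>(i, j). sgn (p i - p j)) ` {(i, j). p i \<noteq> p j})"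
  have N: "N \<ge> 1" using card_UNIV_ge_1[where 'i = 'i] unfolding N_def by linarith
  have V: "finite (V p)" "card (V p) \<le> (CARD('i))\<^sup>2" for p
  proof -
    have "card (V p) \<le> card {(i, j). p i \<noteq> p j}" unfolding V_def by (rule card_image_le) auto
    also have "\<dots> \<le> card (UNIV :: ('i \<times> 'i) set)" by (rule card_mono) auto
    finally show "card (V p) \<le> (CARD('i))\<^sup>2" by (simp add: card_cartesian_product power2_eq_square flip: UNIV_Times_UNIV)
  qed (auto simp: V_def)
  have Vn: "norm v = 1" if "v \<in> V p" for v p using that by (auto simp: V_def norm_sgn)
  have step: "(\<exists>p' :: 'i \<Rightarrow> 'a. clustered p' S' (24 * N ^ 3 * \<eta>\<^sup>2)) \<and>
      (\<exists>z. \<forall>x\<in>S'. norm (x - z) \<le> jung_radius CARD('i) * sqrt (1 + \<eta>\<^sup>2))"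
    if c: "clustered p S \<eta>" "0 \<le> \<eta>" "24 * N ^ 3 * \<eta> \<le> 1" and sub: "S' \<subseteq> S"
      and slab: "\<And>x y v. \<lbrakk>x \<in> S'; y \<in> S'; v \<in> V p\<rbrakk> \<Longrightarrow> \<bar>(x - y) \<bullet> v\<bar> \<le> 2" for p S \<eta> S'
  proof -
    have "\<eta> * (4 * N\<^sup>2) \<le> \<eta> * (24 * N ^ 3)"
    proof (intro mult_left_mono)
      have "N\<^sup>2 \<le> N ^ 3" using N by (intro power_increasing) auto
      thus "4 * N\<^sup>2 \<le> 24 * N ^ 3" using zero_le_power[of N 3] N by linarith
    qed (rule c(2))
    hence \<eta>: "\<eta> * (4 * N\<^sup>2) \<le> 1" using c(3) by (simp add: mult_ac)
    have "\<bar>(x - y) \<bullet> sgn (p i - p j)\<bar> \<le> 2" if "x \<in> S'" "y \<in> S'" "p i \<noteq> p j" for x y i j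
      using that by (intro slab) (auto simp: V_def)
    from clustered_step[OF card c(2) \<eta>[unfolded N_def] c(1) sub this]
    show ?thesis unfolding N_def by blast
  qed
  show ?thesis
    using assms(3-)
  proof (induction k arbitrary: p S \<eta>)
    case 0
    have "solvable ((CARD('i))\<^sup>2 + 0) (jung_radius CARD('i) * sqrt (1 + \<eta>\<^sup>2)) S"
      using step[OF 0] by (intro solvable_queries[OF V(1) Vn V(2), of p]) auto
    thus ?case using N by simp
  next
    case (Suc k)
    define C where "C = 24 * N ^ 3"
    define \<rho> where "\<rho> = jung_radius CARD('i) * sqrt (1 + ((C * \<eta>) ^ (2 ^ Suc k) / C)\<^sup>2)"
    have C: "C \<ge> 0" using N by (simp add: C_def)
    have "solvable ((CARD('i))\<^sup>2 + Suc k * (CARD('i))\<^sup>2) \<rho> S"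
    proof (rule solvable_queries[OF V(1) Vn V(2)])
      fix S' assume S': "S' \<subseteq> S" "\<And>x y v. \<lbrakk>x \<in> S'; y \<in> S'; v \<in> V p\<rbrakk> \<Longrightarrow> \<bar>(x - y) \<bullet> v\<bar> \<le> 2"
      obtain p' :: "'i \<Rightarrow> 'a" where p': "clustered p' S' (C * \<eta>\<^sup>2)"
        using step[OF Suc.prems S'] unfolding C_def by blast
      have eq: "C * (C * \<eta>\<^sup>2) = (C * \<eta>)\<^sup>2" by (simp add: power2_eq_square)
      have "C * (C * \<eta>\<^sup>2) \<le> 1" unfolding eq using Suc.prems(2,3) C by (intro power_le_one) (auto simp: C_def)
      from Suc.IH[folded C_def, OF p' _ this] C
      have "solvable (Suc k * (CARD('i))\<^sup>2) (jung_radius CARD('i) * sqrt (1 + ((C * (C * \<eta>\<^sup>2)) ^ (2 ^ k) / C)\<^sup>2)) S'"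
        by simp
      thus "solvable (Suc k * (CARD('i))\<^sup>2) \<rho> S'"
        unfolding eq \<rho>_def by (simp flip: power_mult)
    qed
    thus ?case unfolding \<rho>_def C_def by simp
  qed
qed

text \<open>The net queries start the iteration at \<open>C * \<eta> = 1 / 2\<close>. The excess
  over the Jung radius is at most the square of the last cluster size, whence the exponent
  \<open>2 ^ Suc k\<close>.\<close>

lemma solvable_doubly_exponential:
  assumes card: "CARD('i::finite) = DIM('a::euclidean_space) + 1"
  obtains T0 where
    "\<And>k. solvable (T0 + Suc k * (CARD('i))\<^sup>2) (jung_radius CARD('i) + (1 / 2) ^ (2 ^ Suc k)) (UNIV :: 'a set)"
proof -
  define C where "C = 24 * real CARD('i) ^ 3"
  have "real CARD('i) ^ 3 \<ge> 1" using card_UNIV_ge_1[where 'i = 'i] by (intro one_le_power) linarith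
  hence C: "C \<ge> 1" unfolding C_def by linarith
  hence h: "0 < 1 / (2 * C)" by simp
  show ?thesis
  proof (rule clustered_initial[OF card h])
    fix V :: "'a set"
    assume V: "finite V" "\<And>v. v \<in> V \<Longrightarrow> norm v = 1"
      "\<And>S. (\<And>x y v. \<lbrakk>x \<in> S; y \<in> S; v \<in> V\<rbrakk> \<Longrightarrow> \<bar>(x - y) \<bullet> v\<bar> \<le> 2) \<Longrightarrow>
         \<exists>p :: 'i \<Rightarrow> 'a. clustered p S (1 / (2 * C))"
    show ?thesis
    proof (rule that[of "card V"])
      fix k
      let ?J = "jung_radius CARD('i)"
      define y where "y = (1 / 2 :: real) ^ (2 ^ k)"
      have y: "(y / C)\<^sup>2 \<le> (1 / 2) ^ (2 ^ Suc k)"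
      proof -
        have "y / C \<le> y" using C by (simp add: y_def divide_le_eq)
        hence "(y / C)\<^sup>2 \<le> y\<^sup>2" using C by (intro power_mono) (auto simp: y_def)
        thus ?thesis by (simp add: y_def mult.commute flip: power_mult)
      qed
      have "sqrt (1 + w) \<le> 1 + w / 2" if "w \<ge> 0" for w :: real
        using that by (intro real_le_lsqrt) (auto simp: power2_eq_square algebra_simps)
      hence "?J * sqrt (1 + (y / C)\<^sup>2) \<le> ?J * (1 + (y / C)\<^sup>2 / 2)"
        using jung_radius_nonneg by (intro mult_left_mono) auto
      also have "\<dots> \<le> ?J + (y / C)\<^sup>2"
        using mult_right_mono[OF jung_radius_le_2[of "CARD('i)"], of "(y / C)\<^sup>2"] by (simp add: algebra_simps)
      finally have \<rho>: "?J * sqrt (1 + (y / C)\<^sup>2) \<le> ?J + (1 / 2) ^ (2 ^ Suc k)" using y by linarith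
      show "solvable (card V + Suc k * (CARD('i))\<^sup>2) (?J + (1 / 2) ^ (2 ^ Suc k)) (UNIV :: 'a set)"
      proof (rule solvable_queries[OF V(1,2) order_refl])
        fix S' :: "'a set"
        assume "\<And>x y v. \<lbrakk>x \<in> S'; y \<in> S'; v \<in> V\<rbrakk> \<Longrightarrow> \<bar>(x - y) \<bullet> v\<bar> \<le> 2"
        then obtain p :: "'i \<Rightarrow> 'a" where "clustered p S' (1 / (2 * C))" using V(3) by metis
        from clustered_solvable[OF card this, folded C_def, of k] C
        have "solvable (Suc k * (CARD('i))\<^sup>2) (?J * sqrt (1 + (y / C)\<^sup>2)) S'" by (simp add: y_def)
        thus "solvable (Suc k * (CARD('i))\<^sup>2) (?J + (1 / 2) ^ (2 ^ Suc k)) S'"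
          using \<rho> by (rule solvable_mono_radius)
      qed
    qed
  qed
qed

section \<open>Strategy of the adversary\<close>

lemma regular_simplex_exists:
  obtains p :: "'n::finite option \<Rightarrow> real^'n" where "\<And>i j. i \<noteq> j \<Longrightarrow> norm (p i - p j) = 2"
proof -
  let ?d = "real CARD('n)"
  have d: "?d \<ge> 1" using card_UNIV_ge_1[where 'i = 'n] by linarith
  \<comment> \<open>Positive root of \<open>?d * t\<^sup>2 - 2 * sqrt 2 * t = 2\<close>, which puts
    the diagonal point at distance 2 from every \<open>axis i (sqrt 2)\<close>.\<close>
  define t where "t = (sqrt 2 + sqrt (2 + 2 * ?d)) / ?d"
  define p :: "'n option \<Rightarrow> real^'n" where
    "p = (\<lambda>i. case i of None \<Rightarrow> (\<chi> j. t) | Some i \<Rightarrow> axis i (sqrt 2))"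
  have "(?d * t - sqrt 2)\<^sup>2 = 2 + 2 * ?d" using d by (simp add: t_def)
  hence "?d * (?d * t\<^sup>2 - 2 * sqrt 2 * t) = ?d * 2" by (simp add: power2_eq_square algebra_simps)
  hence t: "?d * t\<^sup>2 - 2 * sqrt 2 * t = 2" using d by simp
  have "(norm (p (Some i) - p (Some j)))\<^sup>2 = 2\<^sup>2" if "i \<noteq> j" for i j
    using that by (simp add: p_def power2_norm_eq_inner inner_diff inner_axis_axis)
  moreover have "(norm (p None - p (Some i)))\<^sup>2 = 2\<^sup>2" for i
  proof -
    have "(norm (\<chi> j :: 'n. t))\<^sup>2 = ?d * t\<^sup>2" unfolding power2_norm_eq_inner
      by (simp add: inner_vec_def power2_eq_square)
    moreover have "(norm (axis i (sqrt 2) :: real^'n))\<^sup>2 = 2"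
      by (simp add: power2_norm_eq_inner inner_axis_axis)
    ultimately show ?thesis using t by (simp add: p_def norm_diff_sq inner_axis mult_ac)
  qed
  ultimately have sq: "(norm (p i - p j))\<^sup>2 = 2\<^sup>2" if "i \<noteq> j" for i j
    using that by (cases i; cases j) (auto simp: norm_minus_commute)
  have "norm (p i - p j) = 2" if "i \<noteq> j" for i j
    using sq[OF that] by (subst (asm) power2_eq_iff_nonneg) auto
  thus ?thesis by (rule that)
qed

text \<open>Rotation in the plane of \<open>e\<close> and \<open>u\<close> with cosine
  \<open>c\<close> and sine \<open>s\<close>, the identity on the orthogonal complement. As
  \<open>1 - c \<le> s\<close>, the displacement consists of four terms of size at most
  \<open>s * norm x\<close>.\<close>

lemma plane_rotation:
  fixes e u :: "'a::real_inner"
  assumes "norm e = 1" "norm u = 1" "e \<bullet> u = 0" "c\<^sup>2 + s\<^sup>2 = 1" "0 \<le> c" "0 \<le> s"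
  obtains R where "\<And>x y. R (x - y) = R x - R y" "\<And>x. norm (R x) = norm x"
    "R e = c *\<^sub>R e + s *\<^sub>R u" "\<And>x. norm (R x - x) \<le> 4 * s * norm x"
proof -
  define R where "R = (\<lambda>x. x + ((c - 1) * (x \<bullet> e) - s * (x \<bullet> u)) *\<^sub>R e + (s * (x \<bullet> e) + (c - 1) * (x \<bullet> u)) *\<^sub>R u)"
  have eu: "e \<bullet> e = 1" "u \<bullet> u = 1" "u \<bullet> e = 0"
    using assms by (auto simp: inner_commute simp flip: power2_norm_eq_inner)
  have c: "1 - c \<le> s"
  proof -
    have "1\<^sup>2 \<le> (c + s)\<^sup>2" using assms(4-6) by (simp add: power2_sum)
    thus ?thesis using power2_le_imp_le[of 1 "c + s"] assms by simp
  qed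
  have c1: "c \<le> 1"
  proof (rule power2_le_imp_le)
    show "c\<^sup>2 \<le> 1\<^sup>2" unfolding one_power2 using assms(4) zero_le_power2[of s] by linarith
  qed simp
  show ?thesis
  proof (rule that[of R])
    show "R (x - y) = R x - R y" for x y by (simp add: R_def inner_diff_left algebra_simps)
    show "R e = c *\<^sub>R e + s *\<^sub>R u" using eu by (simp add: R_def assms(3) algebra_simps)
    fix x
    define a where "a = x \<bullet> e"
    define b where "b = x \<bullet> u"
    have "R x \<bullet> R x = x \<bullet> x + ((c * a - s * b)\<^sup>2 + (s * a + c * b)\<^sup>2) - (a\<^sup>2 + b\<^sup>2)"
      using eu assms(3)
      by (simp add: R_def inner_add inner_commute[of e x] inner_commute[of u x] flip: a_def b_def)
         (simp add: power2_eq_square algebra_simps)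
    also have "(c * a - s * b)\<^sup>2 + (s * a + c * b)\<^sup>2 = (c\<^sup>2 + s\<^sup>2) * (a\<^sup>2 + b\<^sup>2)"
      by (simp add: power2_eq_square algebra_simps)
    finally show "norm (R x) = norm x" using assms(4) by (simp add: norm_eq_sqrt_inner)
    have ab: "\<bar>a\<bar> \<le> norm x" "\<bar>b\<bar> \<le> norm x"
      using Cauchy_Schwarz_ineq2[of x e] Cauchy_Schwarz_ineq2[of x u] assms by (auto simp: a_def b_def)
    have ca: "\<bar>(c - 1) * y\<bar> \<le> s * norm x" if "\<bar>y\<bar> \<le> norm x" for y
      unfolding abs_mult using that c c1 assms(6) by (intro mult_mono) auto
    have sa: "\<bar>s * y\<bar> \<le> s * norm x" if "\<bar>y\<bar> \<le> norm x" for y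
      unfolding abs_mult using that assms(6) by (intro mult_mono) auto
    have "norm (R x - x) = norm (((c - 1) * a - s * b) *\<^sub>R e + (s * a + (c - 1) * b) *\<^sub>R u)"
      by (simp add: R_def a_def b_def)
    also have "\<dots> \<le> \<bar>(c - 1) * a - s * b\<bar> + \<bar>s * a + (c - 1) * b\<bar>"
      using norm_triangle_ineq[of "((c - 1) * a - s * b) *\<^sub>R e" "(s * a + (c - 1) * b) *\<^sub>R u"] assms(1,2) by simp
    also have "\<dots> \<le> 4 * (s * norm x)"
      using ca[OF ab(1)] ca[OF ab(2)] sa[OF ab(1)] sa[OF ab(2)] by linarith
    finally show "norm (R x - x) \<le> 4 * s * norm x" by simp
  qed
qed

text \<open>Only the edge closest to \<open>v\<close> has to be tilted: two different edges enclose an angle of at least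
  60 degrees, so all others are far from \<open>v\<close>.\<close>

lemma tilt_regular_simplex:
  fixes p :: "'i::finite \<Rightarrow> 'a::euclidean_space"
  assumes dim: "DIM('a) \<ge> 2" and card: "CARD('i) \<ge> 2"
    and p: "\<And>i j. i \<noteq> j \<Longrightarrow> norm (p i - p j) = 2"
    and v: "norm v = 1" and s: "0 \<le> s" "s \<le> 1 / 64"
  obtains p' where "\<And>i j. i \<noteq> j \<Longrightarrow> norm (p' i - p' j) = 2"
    "\<And>i. norm (p' i - p i) \<le> 8 * s" "\<And>i j. \<bar>(p' i - p' j) \<bullet> v\<bar> \<le> 2 - s\<^sup>2"
proof -
  \<comment> \<open>Taken over ordered pairs, so the maximal edge has nonnegative projection and
    dominates all others in absolute value.\<close>
  define f where "f = (\<lambda>(i, j). (p i - p j) \<bullet> v)"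
  let ?P = "{(i :: 'i, j). i \<noteq> j}"
  have "?P \<noteq> {}" using card by (metis (mono_tags, lifting) UNIV_I card_2_iff' case_prodI empty_iff ex_card mem_Collect_eq)
  hence "Max (f ` ?P) \<in> f ` ?P" by (intro Max_in) auto
  then obtain ij where ij: "ij \<in> ?P" "f ij = Max (f ` ?P)" by auto
  obtain i j where [simp]: "ij = (i, j)" by (cases ij)
  have "i \<noteq> j" using ij by simp
  have mx: "(p k - p l) \<bullet> v \<le> (p i - p j) \<bullet> v" if "k \<noteq> l" for k l
  proof -
    have "f (k, l) \<le> f ij" unfolding ij(2) by (rule Max_ge) (use that in auto)
    thus ?thesis by (simp add: f_def)
  qed
  define e where "e = (1 / 2) *\<^sub>R (p i - p j)"
  have pe: "p i - p j = 2 *\<^sub>R e" by (simp add: e_def)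
  have e: "norm e = 1" using p[OF \<open>i \<noteq> j\<close>] by (simp add: e_def)
  have ev: "0 \<le> e \<bullet> v" using mx[of j i] \<open>i \<noteq> j\<close> by (simp add: e_def inner_diff_left)
  have ev1: "e \<bullet> v \<le> 1" using norm_cauchy_schwarz[of e v] e v by simp
  obtain y where y: "y \<noteq> 0" "orthogonal e y" using orthogonal_to_vector_exists[OF dim] by blast
  \<comment> \<open>The sign is chosen so that turning \<open>e\<close> towards \<open>u\<close>
    does not add to its projection on \<open>v\<close>.\<close>
  define u where "u = (if y \<bullet> v \<le> 0 then sgn y else - sgn y)"
  have u: "norm u = 1" "e \<bullet> u = 0"
    using y by (auto simp: u_def norm_sgn orthogonal_def sgn_div_norm)
  have uv: "u \<bullet> v \<le> 0" using y by (auto simp: u_def sgn_div_norm mult_le_0_iff)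
  have uv1: "u \<bullet> v \<ge> - 1" using Cauchy_Schwarz_ineq2[of u v] u v by (simp add: abs_le_iff)
  have s2: "s\<^sup>2 \<le> 1 / 64" using s mult_mono[of s "1/64" s 1] by (simp add: power2_eq_square)
  define c where "c = sqrt (1 - s\<^sup>2)"
  have c: "c\<^sup>2 + s\<^sup>2 = 1" "0 \<le> c" using s2 by (auto simp: c_def)
  have c_le: "2 * c \<le> 2 - s\<^sup>2"
  proof -
    have "(1 - s\<^sup>2 / 2)\<^sup>2 = 1 - s\<^sup>2 + (s\<^sup>2 / 2)\<^sup>2" by (simp add: power2_diff)
    hence "c\<^sup>2 \<le> (1 - s\<^sup>2 / 2)\<^sup>2" using c(1) zero_le_power2[of "s\<^sup>2 / 2"] by linarith
    hence "c \<le> 1 - s\<^sup>2 / 2" using s2 by (intro power2_le_imp_le[of c "1 - s\<^sup>2 / 2"]) auto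
    thus ?thesis by simp
  qed
  obtain R where R: "\<And>x y. R (x - y) = R x - R y" "\<And>x. norm (R x) = norm x"
    "R e = c *\<^sub>R e + s *\<^sub>R u" "\<And>x. norm (R x - x) \<le> 4 * s * norm x"
    using plane_rotation[OF e u c s(1)] by metis
  \<comment> \<open>Rotation about the vertex \<open>p i\<close>; edges have length 2, so no vertex
    moves by more than \<open>4 * s * 2\<close>.\<close>
  define p' where "p' = (\<lambda>k. p i + R (p k - p i))"
  have d: "p' k - p' l = R (p k - p l)" for k l
    using R(1)[of "p k - p i" "p l - p i"] by (simp add: p'_def)
  have R0: "R 0 = 0" using R(2)[of 0] by simp
  have n2: "norm (p k - p l) \<le> 2" for k l using p[of k l] by (cases "k = l") auto
  have near: "norm (R (p k - p l) - (p k - p l)) \<le> 8 * s" for k l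
    using R(4)[of "p k - p l"] mult_left_mono[OF n2[of k l], of "4 * s"] s(1) by linarith
  have main: "\<bar>R (p i - p j) \<bullet> v\<bar> \<le> 2 - s\<^sup>2"
  proof -
    have "R (p i - p j) = 2 *\<^sub>R R e"
      using R(1)[of e "- e"] R(1)[of 0 e] R0 by (simp add: pe scaleR_2)
    hence eq: "R (p i - p j) \<bullet> v = 2 * (c * (e \<bullet> v) + s * (u \<bullet> v))"
      by (simp add: R(3) inner_add_left)
    have le: "\<bar>2 * (X + Y)\<bar> \<le> 2 - b"
      if "X \<le> c" "0 \<le> X" "Y \<le> 0" "- s \<le> Y" "2 * c \<le> 2 - b" "b \<le> 1 / 64" for X Y b
      by (rule abs_leI) (use that s in argo)+
    have "c * (e \<bullet> v) \<le> c" "0 \<le> c * (e \<bullet> v)" using c(2) ev ev1 by (auto simp: mult_left_le)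
    moreover have "s * (u \<bullet> v) \<le> 0" "- s \<le> s * (u \<bullet> v)"
      using s(1) uv uv1 mult_left_mono[OF uv1 s(1)] by (auto simp: mult_le_0_iff)
    ultimately show ?thesis unfolding eq using c_le s2 by (rule le)
  qed
  have other: "\<bar>R (p k - p l) \<bullet> v\<bar> \<le> 2 - s\<^sup>2" if kl: "k \<noteq> l" "(k, l) \<noteq> (i, j)" "(k, l) \<noteq> (j, i)"
    and pos: "(p k - p l) \<bullet> v \<ge> 0" for k l
  proof -
    have sq: "(norm (p a - p b))\<^sup>2 = (if a = b then 0 else 4)" for a b using p[of a b] by simp
    \<comment> \<open>The right-hand side could reach 8 only if both subtracted terms vanished, that
      is, for the edge \<open>(i, j)\<close> itself.\<close>
    have "2 * ((p k - p l) \<bullet> (p i - p j)) = (norm (p k - p j))\<^sup>2 + (norm (p l - p i))\<^sup>2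
        - (norm (p k - p i))\<^sup>2 - (norm (p l - p j))\<^sup>2"
      by (simp add: norm_diff_sq inner_diff)
    also have "\<dots> \<le> 4" using kl \<open>i \<noteq> j\<close> by (auto simp: sq)
    finally have ip: "(p k - p l) \<bullet> (p i - p j) \<le> 2" by simp
    define f where "f = p k - p l"
    \<comment> \<open>The sum of the two edges is shorter than 7/2, and the smaller of their
      projections is at most half of that.\<close>
    have "(norm (f + (p i - p j)))\<^sup>2 \<le> 12"
      using ip sq[of k l] sq[of i j] kl \<open>i \<noteq> j\<close> by (simp add: f_def norm_add_sq)
    also have "(12::real) \<le> (7 / 2)\<^sup>2" by (simp add: power2_eq_square)
    finally have "norm (f + (p i - p j)) \<le> 7 / 2" by (rule power2_le_imp_le) simp
    hence "(f + (p i - p j)) \<bullet> v \<le> 7 / 2"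
      using norm_cauchy_schwarz[of "f + (p i - p j)" v] v by simp
    hence "f \<bullet> v \<le> 7 / 4" using mx[OF kl(1)] by (simp add: f_def inner_add_left)
    moreover have "\<bar>(R f - f) \<bullet> v\<bar> \<le> 8 * s"
      using Cauchy_Schwarz_ineq2[of "R f - f" v] v near[of k l] by (simp add: f_def)
    ultimately have "\<bar>R f \<bullet> v\<bar> \<le> 7 / 4 + 8 * s"
      using pos by (simp add: f_def inner_diff_left abs_le_iff)
    also have "\<dots> \<le> 2 - s\<^sup>2" using s s2 by linarith
    finally show ?thesis by (simp add: f_def)
  qed
  have sym: "R (p k - p l) \<bullet> v = - (R (p l - p k) \<bullet> v)" for k l
    by (simp add: R(1) inner_diff_left)
  show ?thesis
  proof (rule that[of p'])
    show "norm (p' k - p' l) = 2" if "k \<noteq> l" for k l using p[OF that] by (simp add: d R(2))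
    show "norm (p' k - p k) \<le> 8 * s" for k
      using near[of k i] by (simp add: p'_def algebra_simps)
    show "\<bar>(p' k - p' l) \<bullet> v\<bar> \<le> 2 - s\<^sup>2" for k l
    proof -
      consider "k = l" | "(k, l) = (i, j)" | "(k, l) = (j, i)"
        | "k \<noteq> l" "(k, l) \<noteq> (i, j)" "(k, l) \<noteq> (j, i)" "(p k - p l) \<bullet> v \<ge> 0"
        | "k \<noteq> l" "(k, l) \<noteq> (i, j)" "(k, l) \<noteq> (j, i)" "(p l - p k) \<bullet> v \<ge> 0"
        by (auto simp: inner_diff_left) linarith
      thus ?thesis
      proof cases
        case 1 thus ?thesis using s2 by simp
      next
        case 2 thus ?thesis using main by (simp add: d)
      next
        case 3 thus ?thesis using main sym[of i j] by (simp add: d)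
      next
        case 4 thus ?thesis using other by (simp add: d)
      next
        case 5
        have "\<bar>R (p l - p k) \<bullet> v\<bar> \<le> 2 - s\<^sup>2" by (rule other) (use 5 in auto)
        thus ?thesis using sym[of k l] by (simp add: d)
      qed
    qed
  qed
qed

text \<open>Supplies the adversary's answer, the midpoint of the extreme projections.\<close>

lemma midrange:
  fixes a :: "'i::finite \<Rightarrow> real"
  assumes "\<And>i j. \<bar>a i - a j\<bar> \<le> D"
  obtains r where "\<And>i. \<bar>r - a i\<bar> \<le> D / 2"
proof -
  have "Max (range a) \<in> range a" "Min (range a) \<in> range a" by (auto intro: Max_in Min_in)
  then obtain i j where ij: "a i = Max (range a)" "a j = Min (range a)" by (metis imageE)
  have hi: "a k \<le> a i" and lo: "a j \<le> a k" for k unfolding ij by auto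
  have D: "a i - a j \<le> D" using assms[of i j] by simp
  have "\<bar>(a i + a j) / 2 - a k\<bar> \<le> D / 2" for k
  proof (rule abs_leI)
    show "(a i + a j) / 2 - a k \<le> D / 2" using hi[of k] lo[of k] D by argo
    show "- ((a i + a j) / 2 - a k) \<le> D / 2" using hi[of k] lo[of k] D by argo
  qed
  thus ?thesis by (rule that)
qed

lemma consistent_append:
  "length r = T \<Longrightarrow> consistent Q (Suc T) \<delta> x (r @ [a]) \<longleftrightarrow> consistent Q T \<delta> x r \<and> \<bar>a - x \<bullet> Q r\<bar> \<le> \<delta>"
  unfolding consistent_def by (auto simp: less_Suc_eq nth_append)

text \<open>The ball radius starts at 1/4 and follows \<open>h' = h\<^sup>2 / 512\<close>: tilting
  by \<open>s = h / 16\<close> moves vertices by at most \<open>h / 2\<close>, and the shortened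
  projections leave room \<open>s\<^sup>2 / 2 = h\<^sup>2 / 512\<close> around the answer.\<close>

lemma adversary_keeps_simplex:
  fixes Q :: "real list \<Rightarrow> real^'n::finite"
  assumes Q: "unit_queries Q" and dim: "CARD('n) \<ge> 2"
  shows "\<exists>r (p :: 'n option \<Rightarrow> real^'n). length r = T \<and> (\<forall>i j. i \<noteq> j \<longrightarrow> norm (p i - p j) = 2) \<and>
    (\<forall>i x. norm (x - p i) \<le> 512 * (1 / 2) ^ (11 * 2 ^ T) \<longrightarrow> consistent Q T 1 x r)"
proof (induction T)
  case 0
  obtain p :: "'n option \<Rightarrow> real^'n" where "\<And>i j. i \<noteq> j \<Longrightarrow> norm (p i - p j) = 2"
    using regular_simplex_exists by blast
  thus ?case by (auto simp: consistent_def)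
next
  case (Suc T)
  then obtain r and p :: "'n option \<Rightarrow> real^'n" where r: "length r = T"
    and p: "\<And>i j. i \<noteq> j \<Longrightarrow> norm (p i - p j) = 2"
    and con: "\<And>i x. norm (x - p i) \<le> 512 * (1 / 2) ^ (11 * 2 ^ T) \<Longrightarrow> consistent Q T 1 x r" by blast
  define h where "h = 512 * (1 / 2 :: real) ^ (11 * 2 ^ T)"
  define h' where "h' = 512 * (1 / 2 :: real) ^ (11 * 2 ^ Suc T)"
  have "(1 / 2 :: real) ^ (11 * 2 ^ Suc T) = ((1 / 2) ^ (11 * 2 ^ T))\<^sup>2"
    unfolding power_mult[symmetric] by simp
  hence h': "h' = h\<^sup>2 / 512" by (simp add: h_def h'_def power2_eq_square)
  have "(1 / 2 :: real) ^ (11 * 2 ^ T) \<le> (1 / 2) ^ 11"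
    by (rule power_decreasing) auto
  also have "(1 / 2 :: real) ^ 11 = 1 / 2048" by (simp add: power_divide)
  finally have h: "0 < h" "h \<le> 1 / 4" by (auto simp: h_def)
  obtain p' where p': "\<And>i j. i \<noteq> j \<Longrightarrow> norm (p' i - p' j) = 2"
    "\<And>i. norm (p' i - p i) \<le> 8 * (h / 16)" "\<And>i j. \<bar>(p' i - p' j) \<bullet> Q r\<bar> \<le> 2 - (h / 16)\<^sup>2"
    using tilt_regular_simplex[of p "Q r" "h / 16"] p Q dim h by (auto simp: unit_queries_def)
  have "\<bar>p' i \<bullet> Q r - p' j \<bullet> Q r\<bar> \<le> 2 - (h / 16)\<^sup>2" for i j
    using p'(3)[of i j] by (simp add: inner_diff_left)
  then obtain a where a: "\<And>i. \<bar>a - p' i \<bullet> Q r\<bar> \<le> (2 - (h / 16)\<^sup>2) / 2"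
    using midrange[of "\<lambda>i. p' i \<bullet> Q r"] by metis
  have "consistent Q (Suc T) 1 x (r @ [a])" if x: "norm (x - p' i) \<le> h'" for x i
  proof -
    have "h\<^sup>2 \<le> h" using h by (simp add: power2_eq_square mult_left_le)
    hence "norm (x - p i) \<le> h"
      using x p'(2)[of i] norm_triangle_ineq[of "x - p' i" "p' i - p i"] h h' by simp
    hence "consistent Q T 1 x r" using con by (simp add: h_def)
    moreover have "\<bar>a - x \<bullet> Q r\<bar> \<le> 1"
    proof -
      have "\<bar>(x - p' i) \<bullet> Q r\<bar> \<le> h'"
        using Cauchy_Schwarz_ineq2[of "x - p' i" "Q r"] Q x by (simp add: unit_queries_def)
      hence "\<bar>x \<bullet> Q r - p' i \<bullet> Q r\<bar> \<le> h\<^sup>2 / 512" by (simp add: inner_diff_left h')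
      moreover have "(2 - (h / 16)\<^sup>2) / 2 = 1 - h\<^sup>2 / 512" by (simp add: power2_eq_square)
      ultimately show ?thesis using a[of i] by linarith
    qed
    ultimately show ?thesis using r by (simp add: consistent_append)
  qed
  thus ?case using r p'(1) unfolding h'_def by (intro exI[of _ "r @ [a]"] exI[of _ p']) auto
qed

text \<open>The mean squared distance from the output to the vertices is at least their variance,
  the squared Jung radius, so some vertex is that far away. Pushing it further out within its ball
  adds the radius of the ball.\<close>

lemma adversary_forces_error:
  fixes Q Out :: "real list \<Rightarrow> real^'n::finite"
  assumes Q: "unit_queries Q" and dim: "CARD('n) \<ge> 2"
  shows "\<exists>x r. consistent Q T 1 x r \<and>
    norm (Out r - x) \<ge> jung_radius (Suc CARD('n)) + 512 * (1 / 2) ^ (11 * 2 ^ T)"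
proof -
  let ?J = "jung_radius (Suc CARD('n))"
  let ?N = "real CARD('n option)"
  define h where "h = 512 * (1 / 2 :: real) ^ (11 * 2 ^ T)"
  obtain r and p :: "'n option \<Rightarrow> real^'n" where
    p: "\<And>i j. i \<noteq> j \<Longrightarrow> norm (p i - p j) = 2"
    and con: "\<And>i x. norm (x - p i) \<le> h \<Longrightarrow> consistent Q T 1 x r"
    using adversary_keeps_simplex[OF assms, of T] unfolding h_def by blast
  define z where "z = Out r"
  have J: "?J\<^sup>2 = 2 * (1 - 1 / ?N)" by (simp add: jung_radius_sq)
  have "?J\<^sup>2 > 0" unfolding J by (simp add: field_simps)
  have "\<exists>i. ?J\<^sup>2 \<le> (norm (p i - z))\<^sup>2"
  proof (rule ccontr)
    assume "\<not> ?thesis"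
    hence "(\<Sum>i\<in>UNIV. 1 / ?N * (norm (p i - z))\<^sup>2) < (\<Sum>i\<in>(UNIV :: 'n option set). 1 / ?N * ?J\<^sup>2)"
      by (intro sum_strict_mono mult_strict_left_mono) (auto simp: not_le)
    also have "\<dots> = ?J\<^sup>2" by simp
    also have "\<dots> = gvar (\<lambda>_. 1 / ?N) p" unfolding J using p by (subst gvar_regular) auto
    also have "\<dots> \<le> (\<Sum>i\<in>UNIV. 1 / ?N * (norm (p i - z))\<^sup>2)"
      by (subst sum_weighted_dist_sq) auto
    finally show False by simp
  qed
  then obtain i where i: "?J\<^sup>2 \<le> (norm (p i - z))\<^sup>2" by blast
  hence Ji: "?J \<le> norm (p i - z)" by (rule power2_le_imp_le) simp
  have "p i \<noteq> z" using i \<open>?J\<^sup>2 > 0\<close> by auto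
  define x where "x = p i + h *\<^sub>R sgn (p i - z)"
  have "h \<ge> 0" by (simp add: h_def)
  have "norm (x - p i) \<le> h" using \<open>p i \<noteq> z\<close> \<open>h \<ge> 0\<close> by (simp add: x_def norm_sgn)
  moreover have "norm (z - x) = norm (p i - z) + h"
  proof -
    have "x - z = (norm (p i - z) + h) *\<^sub>R sgn (p i - z)"
      using \<open>p i \<noteq> z\<close> by (simp add: x_def scaleR_add_left) (simp add: sgn_div_norm)
    hence "norm (x - z) = \<bar>norm (p i - z) + h\<bar>" using \<open>p i \<noteq> z\<close> by (simp add: norm_sgn)
    thus ?thesis using \<open>h \<ge> 0\<close> by (simp add: norm_minus_commute)
  qed
  ultimately show ?thesis
    using con Ji unfolding h_def z_def by (intro exI[of _ x] exI[of _ r]) auto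
qed

section \<open>Bounds on the optimal error\<close>

text \<open>Homogeneity: scaling secrets, answers and histories together reduces any \<delta> to
  1.\<close>

lemma consistent_scale:
  assumes "\<delta> > 0"
  shows "consistent Q T \<delta> (\<delta> *\<^sub>R x) (map ((*) \<delta>) r) \<longleftrightarrow> consistent (\<lambda>h. Q (map ((*) \<delta>) h)) T 1 x r"
proof -
  have "\<bar>\<delta> * a - \<delta> * b\<bar> \<le> \<delta> \<longleftrightarrow> \<bar>a - b\<bar> \<le> 1" for a b
    using assms by (simp add: abs_mult flip: right_diff_distrib)
  thus ?thesis unfolding consistent_def by (auto simp: take_map)
qed

lemma OPT_le:
  assumes "solvable T \<rho> (UNIV :: (real^'n::finite) set)" "\<delta> > 0"
  shows "OPT TYPE('n) T \<delta> \<le> ereal (\<delta> * \<rho>)"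
proof -
  obtain Q :: "real list \<Rightarrow> real^'n" and Out where Q: "unit_queries Q"
    and Out: "\<And>x r. consistent Q T 1 x r \<Longrightarrow> norm (Out r - x) \<le> \<rho>"
    using solvable_imp_strategy[OF assms(1)] by auto
  define Q' where "Q' = (\<lambda>h. Q (map ((*) (1 / \<delta>)) h))"
  define Out' where "Out' = (\<lambda>r. \<delta> *\<^sub>R Out (map ((*) (1 / \<delta>)) r))"
  have inv: "map ((*) (1 / \<delta>)) (map ((*) \<delta>) h) = h" "map ((*) \<delta>) (map ((*) (1 / \<delta>)) h) = h" for h
    using assms(2) by (simp_all add: o_def)
  have "norm (Out' r - x) \<le> \<delta> * \<rho>" if c: "consistent Q' T \<delta> x r" for x r
  proof -
    define y where "y = (1 / \<delta>) *\<^sub>R x"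
    define s where "s = map ((*) (1 / \<delta>)) r"
    have x: "x = \<delta> *\<^sub>R y" and r: "r = map ((*) \<delta>) s"
      using assms(2) inv(2)[of r] by (simp_all add: y_def s_def)
    have "consistent Q T 1 y s"
      using c unfolding x r consistent_scale[OF assms(2)] by (simp only: Q'_def inv)
    hence "\<delta> * norm (Out s - y) \<le> \<delta> * \<rho>" using Out assms(2) by simp
    moreover have "Out' r - x = \<delta> *\<^sub>R (Out s - y)"
      unfolding Out'_def s_def[symmetric] x by (simp add: algebra_simps)
    ultimately show ?thesis using assms(2) by simp
  qed
  hence "recon_err T \<delta> Q' Out' \<le> ereal (\<delta> * \<rho>)"
    unfolding recon_err_def by (intro SUP_least) auto
  moreover have "unit_queries Q'" using Q by (auto simp: unit_queries_def Q'_def)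
  ultimately show ?thesis
    unfolding OPT_def by (intro INF_lower2[of "(Q', Out')"]) auto
qed

lemma OPT_ge:
  assumes dim: "CARD('n::finite) \<ge> 2" and \<delta>: "\<delta> > 0"
  shows "OPT TYPE('n) T \<delta> \<ge> ereal (\<delta> * (jung_radius (Suc CARD('n)) + 512 * (1 / 2) ^ (11 * 2 ^ T)))"
  unfolding OPT_def
proof (rule INF_greatest, clarify)
  fix Q Out :: "real list \<Rightarrow> real^'n"
  assume Q: "unit_queries Q"
  let ?R = "jung_radius (Suc CARD('n)) + 512 * (1 / 2) ^ (11 * 2 ^ T)"
  let ?m = "map ((*) \<delta>)"
  have "unit_queries (\<lambda>h. Q (?m h))" using Q by (simp add: unit_queries_def)
  then obtain x r where c: "consistent (\<lambda>h. Q (?m h)) T 1 x r"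
    and far: "norm ((1 / \<delta>) *\<^sub>R Out (?m r) - x) \<ge> ?R"
    using adversary_forces_error[of "\<lambda>h. Q (?m h)" T "\<lambda>r. (1 / \<delta>) *\<^sub>R Out (?m r)"] dim by blast
  have "consistent Q T \<delta> (\<delta> *\<^sub>R x) (?m r)" using c consistent_scale[OF \<delta>] by blast
  hence "ereal (norm (Out (?m r) - \<delta> *\<^sub>R x)) \<le> recon_err T \<delta> Q Out"
    unfolding recon_err_def by (intro SUP_upper2[of "(\<delta> *\<^sub>R x, ?m r)"]) auto
  moreover have "Out (?m r) - \<delta> *\<^sub>R x = \<delta> *\<^sub>R ((1 / \<delta>) *\<^sub>R Out (?m r) - x)"
    using \<delta> by (simp add: scaleR_diff_right)
  hence "norm (Out (?m r) - \<delta> *\<^sub>R x) = \<delta> * norm ((1 / \<delta>) *\<^sub>R Out (?m r) - x)"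
    using \<delta> by simp
  hence "\<delta> * ?R \<le> norm (Out (?m r) - \<delta> *\<^sub>R x)" using far \<delta> by simp
  ultimately show "ereal (\<delta> * ?R) \<le> recon_err T \<delta> (fst (Q, Out)) (snd (Q, Out))"
    by (metis ereal_less_eq(3) fst_conv order_trans snd_conv)
qed

text \<open>Fits blocks of \<open>m\<close> rounds into the \<open>T - T1\<close> rounds left after
  the net. For \<open>T \<ge> 2 * (T1 + m)\<close> they cover at least half of \<open>T\<close>,
  whence \<open>a = 1 / (2 * m)\<close>.\<close>

lemma OPT_le_doubly_exponential:
  obtains a :: real and T0 :: nat where "a > 0"
    "\<And>T \<delta>. T \<ge> T0 \<Longrightarrow> \<delta> > 0 \<Longrightarrow> OPT TYPE('n::finite) T \<delta>
       \<le> ereal (\<delta> * (jung_radius (Suc CARD('n)) + 2 powr (- (2 powr (a * real T)))))"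
proof -
  define m where "m = (CARD('n option))\<^sup>2"
  have m: "m > 0" by (simp add: m_def)
  have "CARD('n option) = DIM(real^'n) + 1" by simp
  then obtain T1 where T1:
    "\<And>k. solvable (T1 + Suc k * m) (jung_radius CARD('n option) + (1 / 2) ^ (2 ^ Suc k)) (UNIV :: (real^'n) set)"
    using solvable_doubly_exponential[where 'a = "real^'n" and 'i = "'n option"] unfolding m_def by metis
  define a where "a = 1 / (2 * real m)"
  show ?thesis
  proof (rule that[of a "2 * (T1 + m)"])
    show "a > 0" using m by (simp add: a_def)
    fix T and \<delta> :: real
    assume T: "T \<ge> 2 * (T1 + m)" and \<delta>: "\<delta> > 0"
    define k where "k = (T - T1) div m - 1"
    have "(T - T1) div m \<ge> 1" using T m by (simp add: Suc_le_eq div_greater_zero_iff)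
    hence k: "Suc k = (T - T1) div m" by (simp add: k_def)
    have "Suc k * m \<le> T - T1" unfolding k by (rule div_times_less_eq_dividend)
    hence "T1 + Suc k * m \<le> T" using T by (simp add: le_diff_conv2)
    from solvable_mono_rounds[OF T1 this]
    have sol: "solvable T (jung_radius CARD('n option) + (1 / 2) ^ (2 ^ Suc k)) (UNIV :: (real^'n) set)" .
    have "T - T1 < Suc (Suc k) * m" unfolding k using dividend_less_div_times[OF m, of "T - T1"] by simp
    hence "real T - real T1 < (real (Suc k) + 1) * real m"
      using T by (metis add.commute of_nat_Suc of_nat_diff of_nat_less_iff of_nat_mult le_add1 order_trans mult_2 trans_le_add1)
    moreover have "real (2 * T1 + 2 * m) \<le> real T" using T by (simp only: of_nat_le_iff) simp
    hence "real T \<ge> 2 * real T1 + 2 * real m" by simp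
    ultimately have "real T \<le> 2 * (real (Suc k) * real m)" by (simp add: algebra_simps)
    hence "a * real T \<le> real (Suc k)" using m by (simp add: a_def field_simps)
    hence "2 powr (a * real T) \<le> 2 powr real (Suc k)" by simp
    also have "\<dots> = real (2 ^ Suc k)" unfolding of_nat_power of_nat_numeral by (rule powr_realpow) simp
    finally have "2 powr (- real (2 ^ Suc k)) \<le> 2 powr (- (2 powr (a * real T)))" by simp
    moreover have "2 powr (- real (2 ^ Suc k)) = (1 / 2) ^ (2 ^ Suc k)"
      unfolding powr_minus powr_realpow[OF zero_less_numeral] by (simp add: power_divide inverse_eq_divide)
    ultimately have "(1 / 2) ^ (2 ^ Suc k) \<le> 2 powr (- (2 powr (a * real T)))" by (simp only:)
    hence "jung_radius CARD('n option) + (1 / 2) ^ (2 ^ Suc k)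
      \<le> jung_radius (Suc CARD('n)) + 2 powr (- (2 powr (a * real T)))" by simp
    from OPT_le[OF solvable_mono_radius[OF sol this] \<delta>]
    show "OPT TYPE('n) T \<delta> \<le> ereal (\<delta> * (jung_radius (Suc CARD('n)) + 2 powr (- (2 powr (a * real T)))))" .
  qed
qed

section \<open>The limit and the final comparison\<close>

lemma powr_minus_powr_tendsto_0:
  assumes "a > 0"
  shows "(\<lambda>T. 2 powr (- (2 powr (a * real T)))) \<longlonglongrightarrow> (0::real)"
proof -
  have up: "filterlim (\<lambda>y :: real. y * ln 2) at_top at_top"
    by (intro filterlim_at_top_mult_tendsto_pos[OF tendsto_const _ filterlim_ident]) simp
  have "filterlim (\<lambda>T. a * real T) at_top sequentially"
    by (rule filterlim_tendsto_pos_mult_at_top[OF tendsto_const assms filterlim_real_sequentially])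
  from filterlim_compose[OF filterlim_compose[OF exp_at_top up] this]
  have "filterlim (\<lambda>T. 2 powr (a * real T)) at_top sequentially" by (simp add: powr_def)
  from filterlim_compose[OF up this]
  have "filterlim (\<lambda>T. - (2 powr (a * real T) * ln 2)) at_bot sequentially"
    by (simp add: filterlim_uminus_at_bot)
  from filterlim_compose[OF exp_at_bot this] show ?thesis by (simp add: powr_def)
qed

theorem theorem2:
  assumes "CARD('n::finite) \<ge> 2"
  shows "\<exists>a A :: real. \<exists>T' :: int. a > 0 \<and> A > 0 \<and>
    (\<forall>\<delta>::real. \<forall>T::nat. \<delta> > 0 \<and> int T > T' \<longrightarrow>
       ereal (\<delta> * 2 powr (- (2 powr (A * real T)))) \<le> ExcessErr TYPE('n) T \<delta> \<and>
       ExcessErr TYPE('n) T \<delta> \<le> ereal (\<delta> * 2 powr (- (2 powr (a * real T)))))"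
proof -
  define J where "J = jung_radius (Suc CARD('n))"
  obtain a :: real and T0 :: nat where a: "a > 0"
    and up: "\<And>T \<delta>. T \<ge> T0 \<Longrightarrow> \<delta> > 0 \<Longrightarrow> OPT TYPE('n) T \<delta>
       \<le> ereal (\<delta> * (J + 2 powr (- (2 powr (a * real T)))))"
    unfolding J_def using OPT_le_doubly_exponential[where 'n = 'n] by metis
  have low: "ereal (\<delta> * (J + 512 * (1 / 2) ^ (11 * 2 ^ T))) \<le> OPT TYPE('n) T \<delta>" if "\<delta> > 0" for T \<delta>
    unfolding J_def using OPT_ge[OF assms that] .
  \<comment> \<open>The two bounds squeeze \<open>OPT\<close>, so the excess is measured from
    \<open>\<delta> * J\<close>.\<close>
  have inf: "OPT_inf TYPE('n) \<delta> = ereal (\<delta> * J)" if \<delta>: "\<delta> > 0" for \<delta>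
    unfolding OPT_inf_def
  proof (rule limI, rule tendsto_sandwich)
    show "\<forall>\<^sub>F T in sequentially. ereal (\<delta> * J) \<le> OPT TYPE('n) T \<delta>"
    proof (intro always_eventually allI)
      fix T
      have "ereal (\<delta> * J) \<le> ereal (\<delta> * (J + 512 * (1 / 2) ^ (11 * 2 ^ T)))"
        using \<delta> by (simp add: distrib_left)
      thus "ereal (\<delta> * J) \<le> OPT TYPE('n) T \<delta>" using low[OF \<delta>] order_trans by blast
    qed
    show "\<forall>\<^sub>F T in sequentially. OPT TYPE('n) T \<delta> \<le> ereal (\<delta> * (J + 2 powr (- (2 powr (a * real T)))))"
      using eventually_ge_at_top[of T0] by eventually_elim (rule up[OF _ \<delta>])
    have "(\<lambda>T. \<delta> * (J + 2 powr (- (2 powr (a * real T))))) \<longlonglongrightarrow> \<delta> * (J + 0)"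
      using powr_minus_powr_tendsto_0[OF a] by (intro tendsto_intros)
    thus "(\<lambda>T. ereal (\<delta> * (J + 2 powr (- (2 powr (a * real T)))))) \<longlonglongrightarrow> ereal (\<delta> * J)" by simp
  qed simp
  have "ereal (\<delta> * 2 powr (- (2 powr (5 * real T)))) \<le> ExcessErr TYPE('n) T \<delta> \<and>
       ExcessErr TYPE('n) T \<delta> \<le> ereal (\<delta> * 2 powr (- (2 powr (a * real T))))"
    if \<delta>: "\<delta> > 0" and T: "T > T0" for T \<delta>
  proof -
    have ub: "OPT TYPE('n) T \<delta> \<le> ereal (\<delta> * (J + 2 powr (- (2 powr (a * real T)))))"
      using up T \<delta> by simp
    \<comment> \<open>Finiteness of \<open>OPT\<close> turns the extended real difference into a
      real one.\<close>
    then obtain w where w: "OPT TYPE('n) T \<delta> = ereal w"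
      using low[OF \<delta>, of T] by (cases "OPT TYPE('n) T \<delta>") auto
    have ex: "ExcessErr TYPE('n) T \<delta> = ereal (w - \<delta> * J)"
      by (simp add: ExcessErr_def inf[OF \<delta>] w)
    have "2 powr (- (2 powr (5 * real T))) \<le> 512 * (1 / 2 :: real) ^ (11 * 2 ^ T)"
    proof -
      \<comment> \<open>Source of the constant 5: \<open>T > T0\<close> gives
        \<open>T \<ge> 1\<close>, hence \<open>4 + T \<le> 5 * T\<close>.\<close>
      have "real (11 * 2 ^ T) \<le> 2 ^ (4 + T)" by (simp add: power_add)
      also have "\<dots> = 2 powr real (4 + T)" by (rule powr_realpow[symmetric]) simp
      also have "\<dots> \<le> 2 powr (5 * real T)" using T by simp
      finally have "2 powr (- (2 powr (5 * real T))) \<le> 2 powr (- real (11 * 2 ^ T))" by simp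
      also have "\<dots> = (1 / 2) ^ (11 * 2 ^ T)"
        unfolding powr_minus powr_realpow[OF zero_less_numeral] by (simp add: power_divide inverse_eq_divide)
      also have "\<dots> \<le> 512 * (1 / 2) ^ (11 * 2 ^ T)" by simp
      finally show ?thesis .
    qed
    hence "\<delta> * 2 powr (- (2 powr (5 * real T))) \<le> \<delta> * (512 * (1 / 2) ^ (11 * 2 ^ T))"
      using \<delta> by simp
    thus ?thesis using low[OF \<delta>, of T] ub unfolding w ex by (simp add: algebra_simps)
  qed
  thus ?thesis
    using a by (intro exI[of _ a] exI[of _ "5::real"] exI[of _ "int T0"]) auto
qed

end
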